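(* Given any finite collection $\mathcal G\subset\mathcal F$, there exists a set $E\subset[0,1]$ with $\dim_{\mathbb F}E=1$ such that $E$ contains no nontrivial zero of any $f\in\mathcal G$.
   Context: $\mathbb N=\{1,2,\ldots\}$. For $v\ge2$, $\mathcal F_v(\mathbb N)$ is the set of functions $f(x_0,\ldots,x_v)=m_0x_0-\sum_{i=1}^v m_ix_i$ with $m_0,\ldots,m_v\in\mathbb N$, $m_0=\sum_{i=1}^v m_i$ and $\gcd(m_0,m_1,\ldots,m_v)=1$; and $\mathcal F=\bigcup_{v=2}^\infty\mathcal F_v(\mathbb N)$. For $f\in\mathcal F_v(\mathbb N)$, a nontrivial zero of $f$ in $E$ is a point $(x_0,\ldots,x_v)\in E^{v+1}$ with all entries distinct such that $f(x_0,\ldots,x_v)=0$. The Fourier transform of a measure $\mu$ is $\widehat\mu(\xi)=\int e^{-ix\xi}\,d\mu(x)$. The Fourier dimension $\dim_{\mathbb F}(A)$ of a Borel set $A\subseteq\mathbb R$ is the supremum of exponents $\beta\le 1$ for which there exist a probability measure $\mu$ supported on $A$ and a finite constant $C_2>0$ with $|\widehat\mu(\xi)|\le C_2(1+|\xi|)^{-\beta/2}$ for all $\xi\in\mathbb R$. *)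

theory Defs
  imports "HOL-Probability.Probability"
begin

text \<open>
  A linear form in the variables \<open>x\<^sub>0, \<dots>, x\<^sub>v\<close> is represented as a function of a sequence
  \<open>x :: nat \<Rightarrow> real\<close> that depends on \<open>x 0, \<dots>, x v\<close> only. Since all coefficients are positive,
  the number \<open>v\<close> is determined by the function.
\<close>

definition forms :: "nat \<Rightarrow> ((nat \<Rightarrow> real) \<Rightarrow> real) set" where
  "forms v = {f. \<exists>m :: nat \<Rightarrow> nat.
      (\<forall>i\<le>v. 1 \<le> m i) \<and>
      m 0 = (\<Sum>i=1..v. m i) \<and>
      Gcd (m ` {0..v}) = 1 \<and>
      f = (\<lambda>x. real (m 0) * x 0 - (\<Sum>i=1..v. real (m i) * x i))}"

definition all_forms :: "((nat \<Rightarrow> real) \<Rightarrow> real) set" where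
  "all_forms = (\<Union>v\<in>{2..}. forms v)"

definition nontrivial_zero ::
  "nat \<Rightarrow> ((nat \<Rightarrow> real) \<Rightarrow> real) \<Rightarrow> real set \<Rightarrow> (nat \<Rightarrow> real) \<Rightarrow> bool" where
  "nontrivial_zero v f E x \<longleftrightarrow> (\<forall>i\<le>v. x i \<in> E) \<and> inj_on x {0..v} \<and> f x = 0"

text \<open>The sign in the exponent is opposite to the one in \<^const>\<open>char\<close>.\<close>

definition fourier_transform :: "real measure \<Rightarrow> real \<Rightarrow> complex" where
  "fourier_transform \<mu> \<xi> = (CLINT x|\<mu>. exp (- \<i> * complex_of_real (x * \<xi>)))"

definition measure_support :: "real measure \<Rightarrow> real set" where
  "measure_support \<mu> = {x. \<forall>U. open U \<longrightarrow> x \<in> U \<longrightarrow> emeasure \<mu> U > 0}"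

text \<open>
  ``Supported on \<open>A\<close>'' is read as: the closed topological support is contained in \<open>A\<close>. This implies
  that the complement of \<open>A\<close> is a null set, so the lower bounds on the dimension obtained here
  also hold if one only asks for \<open>\<mu>(A) = 1\<close>. The supremum is taken in \<^typ>\<open>ereal\<close> so that it is
  meaningful for \<open>A = {}\<close> (where it is \<open>-\<infinity>\<close>); for nonempty \<open>A\<close> it lies in \<open>[0, 1]\<close>.
\<close>

definition fourier_dim :: "real set \<Rightarrow> ereal" where
  "fourier_dim A = (SUP \<beta> \<in> {\<beta> :: real. \<beta> \<le> 1 \<and>
      (\<exists>\<mu> C. real_distribution \<mu> \<and> measure_support \<mu> \<subseteq> A \<and> 0 < C \<and>
        (\<forall>\<xi>. norm (fourier_transform \<mu> \<xi>) \<le> C * (1 + \<bar>\<xi>\<bar>) powr (- \<beta> / 2)))}. ereal \<beta>)"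

end

theory Submission
  imports Defs "HOL-Real_Asymp.Real_Asymp"
begin

text \<open>
  The equations say that \<open>x\<^sub>0\<close> is a weighted mean of \<open>x\<^sub>1, \<dots>, x\<^sub>v\<close> with positive rational weights.
  No point of a paraboloid is a proper weighted mean of other points of it, so integers whose
  base-\<open>W\<close> digits are the coordinates of lattice points on a paraboloid satisfy none of the equations
  nontrivially, even modulo \<open>N\<close> and up to a bounded carry. A Cantor set whose digits at each node of
  level \<open>k\<close> range over a translate modulo \<open>N k\<close> of such a digit set therefore contains no
  nontrivial zero: consider the first level at which the points of a zero separate. As the dimension of
  the paraboloid grows with \<open>k\<close>, the digit sets have size \<open>(N k)\<^bsup>1 - o(1)\<^esup>\<close>.

  The translates are chosen at random and independently at each node (after Shmerkin). The change of the
  Fourier transform from one level to the next is then a sum of independent bounded terms of mean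
  zero, and an exponential moment bound gives square-root cancellation simultaneously at all
  frequencies of a fine net. The resulting decay is \<open>|\<xi>|\<^bsup>-a\<^esup>\<close> for every \<open>a < 1/2\<close>.
\<close>

subsection \<open>Balanced choices of translates\<close>

lemma exp_le_one_plus_square:
  fixes x :: real
  assumes "\<bar>x\<bar> \<le> 1"
  shows "exp x \<le> 1 + x + x\<^sup>2"
proof (cases "x \<ge> 0")
  case True
  then show ?thesis using assms by (intro exp_bound) auto
next
  case False
  define y where "y = - x"
  have y: "y > 0" using False by (simp add: y_def)
  \<comment> \<open>The product equals \<open>1 + y ^ 3\<close>.\<close>
  have "1 \<le> (1 + y) * (1 - y + y\<^sup>2)"
    using y by (simp add: algebra_simps power2_eq_square)
  also have "\<dots> \<le> exp y * (1 - y + y\<^sup>2)"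
  proof (rule mult_right_mono)
    have "0 \<le> (1 - y / 2)\<^sup>2 + 3 / 4 * y\<^sup>2" by simp
    then show "0 \<le> 1 - y + y\<^sup>2" by (simp add: power2_eq_square field_simps)
  qed (rule exp_ge_add_one_self)
  finally have "exp (- y) \<le> 1 - y + y\<^sup>2"
    by (simp add: exp_minus divide_simps mult.commute)
  then show ?thesis by (simp add: y_def)
qed

text \<open>Method of conditional expectations. The indices are fixed one at a time: averaged over
  \<open>t\<close>, adjoining an index multiplies the total over \<open>w\<close> by at most
  \<open>K\<close>, so some \<open>t\<close> does no worse than the average.\<close>

lemma exponential_choice:
  fixes a :: "'w \<Rightarrow> 'i \<Rightarrow> 't \<Rightarrow> real" and K :: real
  assumes "finite I" "finite T" "T \<noteq> {}" "K \<ge> 0"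
    and avg: "\<And>w i. w \<in> \<Omega> \<Longrightarrow> i \<in> I \<Longrightarrow> (\<Sum>t\<in>T. exp (a w i t)) \<le> K * card T"
  shows "\<exists>\<tau>. (\<forall>i. \<tau> i \<in> T) \<and>
    (\<Sum>w\<in>\<Omega>. exp (\<Sum>i\<in>I. a w i (\<tau> i))) \<le> card \<Omega> * K ^ card I"
  using \<open>finite I\<close> avg
proof (induction I rule: finite_induct)
  case empty
  obtain t where "t \<in> T" using \<open>T \<noteq> {}\<close> by auto
  then show ?case by (intro exI[of _ "\<lambda>_. t"]) simp
next
  case (insert j I)
  then obtain \<tau> where \<tau>: "\<And>i. \<tau> i \<in> T"
    "(\<Sum>w\<in>\<Omega>. exp (\<Sum>i\<in>I. a w i (\<tau> i))) \<le> card \<Omega> * K ^ card I" by auto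
  define S where "S w = exp (\<Sum>i\<in>I. a w i (\<tau> i))" for w
  have "(\<Sum>t\<in>T. \<Sum>w\<in>\<Omega>. S w * exp (a w j t)) = (\<Sum>w\<in>\<Omega>. S w * (\<Sum>t\<in>T. exp (a w j t)))"
    by (subst sum.swap) (simp add: sum_distrib_left)
  also have "\<dots> \<le> (\<Sum>w\<in>\<Omega>. S w * (K * card T))"
    using insert.prems by (intro sum_mono mult_left_mono) (auto simp: S_def)
  also have "\<dots> = (\<Sum>w\<in>\<Omega>. S w) * (K * card T)" by (simp add: sum_distrib_right)
  also have "\<dots> \<le> (card \<Omega> * K ^ card I) * (K * card T)"
    using \<tau>(2) \<open>K \<ge> 0\<close> by (intro mult_right_mono) (auto simp: S_def)
  also have "\<dots> = (\<Sum>t\<in>T. card \<Omega> * K ^ Suc (card I))" by simp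
  finally have le: "(\<Sum>t\<in>T. \<Sum>w\<in>\<Omega>. S w * exp (a w j t)) \<le> (\<Sum>t\<in>T. card \<Omega> * K ^ Suc (card I))" .
  have "\<exists>t\<in>T. (\<Sum>w\<in>\<Omega>. S w * exp (a w j t)) \<le> card \<Omega> * K ^ Suc (card I)"
  proof (rule ccontr)
    assume "\<not> ?thesis"
    then have "(\<Sum>t\<in>T. card \<Omega> * K ^ Suc (card I)) < (\<Sum>t\<in>T. \<Sum>w\<in>\<Omega>. S w * exp (a w j t))"
      using assms by (intro sum_strict_mono) (auto simp: not_le)
    then show False using le by simp
  qed
  then obtain t where t: "t \<in> T" "(\<Sum>w\<in>\<Omega>. S w * exp (a w j t)) \<le> card \<Omega> * K ^ Suc (card I)"
    by blast
  define \<tau>' where "\<tau>' = \<tau>(j := t)"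
  have "exp (\<Sum>i\<in>insert j I. a w i (\<tau>' i)) = S w * exp (a w j t)" for w
  proof -
    have "(\<Sum>i\<in>I. a w i (\<tau>' i)) = (\<Sum>i\<in>I. a w i (\<tau> i))"
      using insert.hyps by (intro sum.cong) (auto simp: \<tau>'_def)
    then show ?thesis using insert.hyps by (simp add: S_def \<tau>'_def exp_add)
  qed
  then show ?case using t \<tau>(1) insert.hyps
    by (intro exI[of _ \<tau>']) (auto simp: \<tau>'_def)
qed

text \<open>Chernoff bound with a union bound over the tests \<open>w\<close>. The exponential
  moments, summed over all tests, dominate each single one, so only the logarithm of the number of
  tests is lost against square-root cancellation.\<close>

lemma balanced_choice:
  fixes a :: "'w \<Rightarrow> 'i \<Rightarrow> 't \<Rightarrow> real"
  assumes fin: "finite \<Omega>" "finite I" "I \<noteq> {}" "finite T" "T \<noteq> {}" and "c > 0"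
    and bound: "\<And>w i t. w \<in> \<Omega> \<Longrightarrow> i \<in> I \<Longrightarrow> t \<in> T \<Longrightarrow> \<bar>a w i t\<bar> \<le> c"
    and mean: "\<And>w i. w \<in> \<Omega> \<Longrightarrow> i \<in> I \<Longrightarrow> (\<Sum>t\<in>T. a w i t) = 0"
  shows "\<exists>\<tau>. (\<forall>i. \<tau> i \<in> T) \<and>
    (\<forall>w\<in>\<Omega>. (\<Sum>i\<in>I. a w i (\<tau> i)) \<le> c * sqrt (card I) * (ln (card \<Omega>) + 1))"
proof -
  define n where "n = card I"
  have n: "n > 0" using fin by (simp add: n_def card_gt_0_iff)
  \<comment> \<open>At this scale the squared exponents are at most \<open>1 / n\<close>, so the
    \<open>n\<close> factors \<open>exp (1 / n)\<close> multiply to the constant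
    \<open>exp 1\<close>.\<close>
  define l where "l = 1 / (c * sqrt n)"
  have l: "l > 0" using n \<open>c > 0\<close> by (simp add: l_def)
  have lc: "(l * c)\<^sup>2 = 1 / n" "l * c \<le> 1"
    using n \<open>c > 0\<close> by (auto simp: l_def power_divide)
  have "(\<Sum>t\<in>T. exp (l * a w i t)) \<le> exp (1 / n) * card T" if w: "w \<in> \<Omega>" "i \<in> I" for w i
  proof -
    have "(\<Sum>t\<in>T. exp (l * a w i t)) \<le> (\<Sum>t\<in>T. 1 + l * a w i t + 1 / n)"
    proof (rule sum_mono)
      fix t assume t: "t \<in> T"
      have b: "\<bar>l * a w i t\<bar> \<le> l * c"
        using bound[OF w t] l by (simp add: abs_mult)
      have "exp (l * a w i t) \<le> 1 + l * a w i t + (l * a w i t)\<^sup>2"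
        using b lc by (intro exp_le_one_plus_square) linarith
      also have "(l * a w i t)\<^sup>2 \<le> (l * c)\<^sup>2"
        using b by (metis abs_ge_zero power2_abs power_mono)
      finally show "exp (l * a w i t) \<le> 1 + l * a w i t + 1 / n" by (simp add: lc)
    qed
    also have "\<dots> = (1 + 1 / n) * card T"
      using mean[OF w] by (simp add: sum.distrib algebra_simps flip: sum_distrib_left)
    also have "\<dots> \<le> exp (1 / n) * card T"
      by (intro mult_right_mono exp_ge_add_one_self) auto
    finally show ?thesis .
  qed
  then obtain \<tau> where \<tau>: "\<And>i. \<tau> i \<in> T"
    "(\<Sum>w\<in>\<Omega>. exp (\<Sum>i\<in>I. l * a w i (\<tau> i))) \<le> card \<Omega> * exp (1 / n) ^ card I"
    using exponential_choice[of I T "exp (1 / n)" \<Omega> "\<lambda>w i t. l * a w i t"] fin by auto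
  have e1: "exp (1 / real n) ^ card I = exp 1"
    using n by (simp add: n_def flip: exp_of_nat_mult)
  have "(\<Sum>i\<in>I. a w i (\<tau> i)) \<le> c * sqrt (card I) * (ln (card \<Omega>) + 1)" if w: "w \<in> \<Omega>" for w
  proof -
    have card: "card \<Omega> > 0" using fin w by (auto simp: card_gt_0_iff)
    have "exp (\<Sum>i\<in>I. l * a w i (\<tau> i)) \<le> (\<Sum>w\<in>\<Omega>. exp (\<Sum>i\<in>I. l * a w i (\<tau> i)))"
      using fin w by (intro member_le_sum) auto
    also have "\<dots> \<le> card \<Omega> * exp 1" using \<tau>(2) e1 by simp
    also have "\<dots> = exp (ln (card \<Omega>) + 1)" using card by (simp add: exp_add)
    finally have "l * (\<Sum>i\<in>I. a w i (\<tau> i)) \<le> ln (card \<Omega>) + 1" by (simp add: sum_distrib_left)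
    then show ?thesis using n \<open>c > 0\<close> by (simp add: l_def n_def field_simps)
  qed
  then show ?thesis using \<tau>(1) by blast
qed

section \<open>Exponential sums over cyclically translated digits\<close>

lemma norm_cis_diff: "norm (cis x - cis y) \<le> \<bar>x - y\<bar>"
proof -
  have "norm (cis (x - y) - 1) \<le> \<bar>x - y\<bar>"
    using iexp_approx1[of "x - y" 0] by (simp add: cis_conv_exp)
  moreover have "cis x - cis y = cis y * (cis (x - y) - 1)"
    by (simp add: algebra_simps cis_mult)
  ultimately show ?thesis by (simp add: norm_mult)
qed

text \<open>
  The transform of the uniform measure on the translated digits minus that of all digits. Its mean
  over all translates \<open>t\<close> vanishes.
\<close>

definition shift_defect :: "int \<Rightarrow> int set \<Rightarrow> int \<Rightarrow> real \<Rightarrow> complex" where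
  "shift_defect N B t \<theta> = (\<Sum>b\<in>B. cis (\<theta> * of_int ((b + t) mod N))) / card B
     - (\<Sum>j\<in>{0..<N::int}. cis (\<theta> * of_int j)) / N"

lemma sum_shift_mod:
  fixes N b :: int
  assumes "N > 0"
  shows "(\<Sum>t\<in>{0..<N}. h ((b + t) mod N)) = (\<Sum>t\<in>{0..<N}. h t)"
proof (rule sum.reindex_bij_witness[of _ "\<lambda>t. (t - b) mod N" "\<lambda>t. (b + t) mod N"])
qed (use assms in \<open>auto simp: mod_simps\<close>)

lemma sum_shift_defect:
  assumes "N > 0" "finite B" "B \<noteq> {}"
  shows "(\<Sum>t\<in>{0..<N}. shift_defect N B t \<theta>) = 0"
proof -
  have "(\<Sum>t\<in>{0..<N}. (\<Sum>b\<in>B. cis (\<theta> * of_int ((b + t) mod N))) / card B)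
      = (\<Sum>b\<in>B. \<Sum>t\<in>{0..<N::int}. cis (\<theta> * of_int ((b + t) mod N))) / card B"
    by (subst sum.swap) (simp add: sum_divide_distrib)
  also have "\<dots> = (\<Sum>t\<in>{0..<N::int}. cis (\<theta> * of_int t))"
    using assms by (simp add: sum_shift_mod[of N "\<lambda>x. cis (\<theta> * of_int x)"])
  finally show ?thesis
    using assms unfolding shift_defect_def by (simp add: sum_subtractf)
qed

lemma norm_avg_le:
  fixes f :: "'a \<Rightarrow> 'b::real_normed_field"
  assumes "\<And>x. x \<in> A \<Longrightarrow> norm (f x) \<le> K" "K \<ge> 0"
  shows "norm ((\<Sum>x\<in>A. f x) / of_nat (card A)) \<le> K"
proof (cases "card A = 0")
  case False
  have "norm (\<Sum>x\<in>A. f x) \<le> card A * K" using assms by (intro sum_norm_bound) auto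
  then show ?thesis using False by (simp add: norm_divide field_simps)
qed (use assms in auto)

text \<open>Writing \<open>N\<close> as a cardinality turns both terms into averages to which
  \<open>norm_avg_le\<close> applies.\<close>

lemma shift_defect_card:
  assumes "N > 0"
  shows "shift_defect N B t \<theta> = (\<Sum>b\<in>B. cis (\<theta> * of_int ((b + t) mod N))) / card B
     - (\<Sum>j\<in>{0..<N::int}. cis (\<theta> * of_int j)) / of_nat (card {0..<N})"
  using assms by (simp add: shift_defect_def)

lemma norm_shift_defect:
  assumes "N > 0"
  shows "norm (shift_defect N B t \<theta>) \<le> 2"
proof -
  have "norm (shift_defect N B t \<theta>) \<le> 1 + 1"
    unfolding shift_defect_card[OF assms]
    by (intro order_trans[OF norm_triangle_ineq4] add_mono norm_avg_le) auto
  then show ?thesis by simp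
qed

text \<open>After modulation both averages consist of exponentials \<open>cis (x * k)\<close> with
  integers \<open>k\<close> between 0 and \<open>Q * N\<close>, so each average is Lipschitz with
  constant \<open>Q * N\<close>.\<close>

lemma norm_modulated_shift_defect_diff:
  assumes N: "N > 0" and d: "0 \<le> d" "d < Q"
  shows "norm (cis (\<theta> * of_int (d * N)) * shift_defect N B t \<theta> - cis (\<theta>' * of_int (d * N)) * shift_defect N B t \<theta>')
    \<le> 2 * of_int (Q * N) * \<bar>\<theta> - \<theta>'\<bar>" (is "norm (?f \<theta> - ?f \<theta>') \<le> _")
proof -
  define e where "e x y = cis (x * of_int (d * N + y))" for x and y :: int
  have f: "?f x = (\<Sum>b\<in>B. e x ((b + t) mod N)) / card B - (\<Sum>j\<in>{0..<N}. e x j) / of_nat (card {0..<N})" for x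
    unfolding shift_defect_card[OF N] e_def
    by (simp add: algebra_simps sum_distrib_left flip: cis_mult)
  have le: "norm (e \<theta> y - e \<theta>' y) \<le> of_int (Q * N) * \<bar>\<theta> - \<theta>'\<bar>" if "y \<in> {0..<N}" for y
  proof -
    have "(d + 1) * N \<le> Q * N" using d N by (intro mult_right_mono) auto
    then have b: "\<bar>d * N + y\<bar> \<le> Q * N" using that d N by (simp add: algebra_simps)
    have "norm (e \<theta> y - e \<theta>' y) \<le> \<bar>\<theta> * of_int (d * N + y) - \<theta>' * of_int (d * N + y)\<bar>"
      unfolding e_def by (rule norm_cis_diff)
    also have "\<dots> = \<bar>\<theta> - \<theta>'\<bar> * of_int \<bar>d * N + y\<bar>" by (simp add: left_diff_distrib flip: abs_mult)
    also have "\<dots> \<le> \<bar>\<theta> - \<theta>'\<bar> * of_int (Q * N)"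
      using b by (intro mult_left_mono) (simp_all only: of_int_le_iff abs_ge_zero)
    finally show ?thesis by (simp add: mult_ac)
  qed
  have K: "0 \<le> of_int (Q * N) * \<bar>\<theta> - \<theta>'\<bar>" using d N by simp
  have "?f \<theta> - ?f \<theta>' = (\<Sum>b\<in>B. e \<theta> ((b + t) mod N) - e \<theta>' ((b + t) mod N)) / of_nat (card B)
      - (\<Sum>j\<in>{0..<N}. e \<theta> j - e \<theta>' j) / of_nat (card {0..<N})"
    unfolding f by (simp add: sum_subtractf diff_divide_distrib)
  also have "norm \<dots> \<le> of_int (Q * N) * \<bar>\<theta> - \<theta>'\<bar> + of_int (Q * N) * \<bar>\<theta> - \<theta>'\<bar>"
    by (intro order_trans[OF norm_triangle_ineq4] add_mono norm_avg_le le K) (use N in auto)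
  finally show ?thesis by (simp add: mult_ac)
qed

lemma cis_periodic: "cis ((\<theta> + 2 * pi * of_int k) * of_int n) = cis (\<theta> * of_int n)"
proof -
  have "(\<theta> + 2 * pi * of_int k) * of_int n = \<theta> * of_int n + 2 * pi * of_int (k * n)"
    by (simp add: algebra_simps)
  also have "cis \<dots> = cis (\<theta> * of_int n) * cis (2 * pi * of_int (k * n))"
    by (simp only: cis_mult)
  also have "cis (2 * pi * of_int (k * n)) = 1" by (intro cis_multiple_2pi) auto
  finally show ?thesis by simp
qed

lemma shift_defect_periodic:
  "shift_defect N B t (\<theta> + 2 * pi * of_int k) = shift_defect N B t \<theta>"
  unfolding shift_defect_def by (simp only: cis_periodic)

text \<open>\<open>balanced_choice\<close> handles a finite net of frequencies in one period.
  Periodicity and the Lipschitz bound extend the estimate to every real frequency.\<close>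

lemma shift_choice:
  fixes L B :: "int set" and Q N :: int
  assumes L: "finite L" "L \<noteq> {}" "L \<subseteq> {0..<Q}" and N: "N > 0" and B: "finite B" "B \<noteq> {}"
  shows "\<exists>\<tau>. (\<forall>d::int. \<tau> d \<in> {0..<N}) \<and>
    (\<forall>\<theta>. norm (\<Sum>d\<in>L. cis (\<theta> * of_int (d * N)) * shift_defect N B (\<tau> d) \<theta>)
      \<le> (8 * ln (of_int (Q * N)) + 32) * sqrt (card L))"
proof -
  define A where "A = Q * N"
  \<comment> \<open>There are at most \<open>A\<close> summands, each with Lipschitz constant
    \<open>2 * A\<close>, so a net of spacing \<open>2 * pi / A ^ 2\<close> costs only a bounded
    error.\<close>
  define J where "J = nat (A\<^sup>2)"
  define g where "g d t \<theta> = cis (\<theta> * of_int (d * N)) * shift_defect N B t \<theta>" for d t \<theta>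
  have Q: "Q \<ge> 1" using L by force
  have A: "A \<ge> 1" "Q \<le> A" using Q N
    by (auto simp: A_def mult_le_cancel_left1) (smt (verit) mult_le_cancel_left1)+
  have J: "J > 0" "real J = (of_int A)\<^sup>2" using A by (auto simp: J_def)
  have norm_g: "norm (g d t \<theta>) \<le> 2" for d t \<theta>
    using norm_shift_defect[OF N] by (simp add: g_def norm_mult)
  \<comment> \<open>One-sided bounds on \<open>Re (z * w)\<close> for these four rotations bound the
    absolute values of the real and imaginary parts of \<open>w\<close>.\<close>
  define Z where "Z = {1, -1, \<i>, -\<i>}"
  define \<Omega> where "\<Omega> = {0..<int J} \<times> Z"
  define a where "a = (\<lambda>(j, z) d t. Re (z * g d t (2 * pi * of_int j / J)))"
  have Z: "finite Z" "card Z = 4" "\<And>z. z \<in> Z \<Longrightarrow> norm z = 1"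
    by (simp add: Z_def, simp add: Z_def complex_eq_iff, auto simp: Z_def)
  have \<Omega>: "finite \<Omega>" "card \<Omega> = 4 * J" by (auto simp: \<Omega>_def Z card_cartesian_product)
  have "\<bar>a w d t\<bar> \<le> 2" if \<Omega>w: "w \<in> \<Omega>" for w d t
  proof -
    obtain j z where w: "w = (j, z)" "z \<in> Z" using \<Omega>w unfolding \<Omega>_def by blast
    have "\<bar>a w d t\<bar> \<le> norm (z * g d t (2 * pi * of_int j / J))"
      unfolding w a_def by (simp only: prod.case abs_Re_le_cmod)
    then show ?thesis using norm_g[of d t "2 * pi * of_int j / J"] w Z by (simp add: norm_mult)
  qed
  moreover have "(\<Sum>t\<in>{0..<N}. a w d t) = 0" for w d
  proof -
    obtain j z where w: "w = (j, z)" by (cases w)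
    have "(\<Sum>t\<in>{0..<N}. z * g d t \<theta>) = 0" for \<theta>
      unfolding g_def using sum_shift_defect[OF N B]
      by (simp flip: sum_distrib_left)
    then show ?thesis unfolding w a_def by (simp only: prod.case Re_sum[symmetric] zero_complex.simps)
  qed
  ultimately have "\<exists>\<tau>. (\<forall>d. \<tau> d \<in> {0..<N}) \<and>
      (\<forall>w\<in>\<Omega>. (\<Sum>d\<in>L. a w d (\<tau> d)) \<le> 2 * sqrt (card L) * (ln (card \<Omega>) + 1))"
    using \<Omega>(1) L(1,2) N by (intro balanced_choice) simp_all
  then obtain \<tau> where \<tau>: "\<And>d. \<tau> d \<in> {0..<N}"
    "\<And>w. w \<in> \<Omega> \<Longrightarrow> (\<Sum>d\<in>L. a w d (\<tau> d)) \<le> 2 * sqrt (card L) * (ln (card \<Omega>) + 1)"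
    by blast
  define S where "S \<theta> = (\<Sum>d\<in>L. g d (\<tau> d) \<theta>)" for \<theta>
  define K where "K = 2 * sqrt (card L) * (ln (card \<Omega>) + 1)"
  have net: "norm (S (2 * pi * of_int j / J)) \<le> 2 * K" if j: "j \<in> {0..<int J}" for j
  proof -
    define w where "w = S (2 * pi * of_int j / J)"
    have "Re (z * w) \<le> K" if "z \<in> Z" for z
    proof -
      have "Re (z * w) = (\<Sum>d\<in>L. a (j, z) d (\<tau> d))"
        unfolding w_def S_def a_def by (simp only: sum_distrib_left Re_sum prod.case)
      then show ?thesis using \<tau>(2)[of "(j, z)"] that j by (simp add: K_def \<Omega>_def)
    qed
    from this[of 1] this[of "-1"] this[of "\<i>"] this[of "-\<i>"]
    have "\<bar>Re w\<bar> \<le> K" "\<bar>Im w\<bar> \<le> K" by (auto simp: Z_def)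
    then show ?thesis using cmod_le[of w] unfolding w_def by linarith
  qed
  have per: "S (\<theta> + 2 * pi * of_int k) = S \<theta>" for \<theta> k
    unfolding S_def g_def by (simp only: cis_periodic shift_defect_periodic)
  have cardL: "1 \<le> card L" "real (card L) \<le> of_int Q"
  proof -
    show "1 \<le> card L" using L by (simp add: Suc_leI card_gt_0_iff)
    have "card L \<le> card {0..<Q}" using L by (intro card_mono) auto
    then show "real (card L) \<le> of_int Q" using Q by simp
  qed
  have main: "norm (S \<theta>) \<le> (8 * ln (of_int A) + 32) * sqrt (card L)" for \<theta>
  proof -
    define m where "m = \<lfloor>\<theta> * J / (2 * pi)\<rfloor>"
    define \<theta>' where "\<theta>' = 2 * pi * of_int m / J"
    have "\<bar>\<theta> * J / (2 * pi) - m\<bar> \<le> 1" unfolding m_def by linarith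
    then have "2 * pi / J * \<bar>\<theta> * J / (2 * pi) - m\<bar> \<le> 2 * pi / J"
      using J by (simp add: divide_right_mono)
    also have "2 * pi / J * \<bar>\<theta> * J / (2 * pi) - m\<bar> = \<bar>2 * pi / J * (\<theta> * J / (2 * pi) - m)\<bar>"
      using J by (simp add: abs_mult)
    also have "2 * pi / J * (\<theta> * J / (2 * pi) - m) = \<theta> - \<theta>'"
      using J(1) by (simp add: \<theta>'_def field_simps)
    finally have close: "\<bar>\<theta> - \<theta>'\<bar> \<le> 2 * pi / J" .
    have "\<theta>' = 2 * pi * of_int (m mod J) / J + 2 * pi * of_int (m div J)"
    proof -
      have "real_of_int m = real_of_int (m div J * J + m mod J)" by (simp only: div_mult_mod_eq)
      also have "\<dots> = real_of_int (m div J) * real J + real_of_int (m mod J)"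
        by (simp only: of_int_add of_int_mult of_int_of_nat_eq)
      finally have "\<theta>' = 2 * pi * (real_of_int (m div J) * real J + real_of_int (m mod J)) / J"
        unfolding \<theta>'_def by (rule arg_cong[where f = "\<lambda>z. 2 * pi * z / J"])
      then show ?thesis using J(1) by (simp add: add_divide_distrib distrib_left del: of_int_add of_int_mult)
    qed
    then have "norm (S \<theta>') \<le> 2 * K" using per net J by simp
    moreover have "norm (S \<theta> - S \<theta>') \<le> 16 * sqrt (card L)"
    proof -
      have "norm (S \<theta> - S \<theta>') \<le> (\<Sum>d\<in>L. 2 * of_int A * \<bar>\<theta> - \<theta>'\<bar>)"
        unfolding S_def sum_subtractf[symmetric] g_def A_def using L
        by (intro sum_norm_le norm_modulated_shift_defect_diff N) auto
      also have "\<dots> = card L * (2 * of_int A * \<bar>\<theta> - \<theta>'\<bar>)" by simp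
      also have "\<dots> \<le> of_int A * (2 * of_int A * (2 * pi / J))"
        using cardL A close by (intro mult_mono) auto
      also have "\<dots> = 4 * pi" using A by (simp add: J power2_eq_square)
      also have "\<dots> \<le> 16 * 1" using pi_less_4 by simp
      also have "\<dots> \<le> 16 * sqrt (card L)" using cardL by (intro mult_left_mono) auto
      finally show ?thesis .
    qed
    ultimately have "norm (S \<theta>) \<le> 2 * K + 16 * sqrt (card L)"
      using norm_triangle_ineq2[of "S \<theta>" "S \<theta>'"] by linarith
    moreover have "2 * K = (4 * ln 4 + 8 * ln (of_int A) + 4) * sqrt (card L)"
      using A J by (simp add: K_def \<Omega> ln_mult ln_realpow algebra_simps)
    \<comment> \<open>The constant 32 is made of \<open>4 * 3 + 4\<close> from the net and 16 from
      passing to nearby frequencies.\<close>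
    moreover have "ln 4 \<le> (3::real)" using ln_le_minus_one[of "4::real"] by simp
    moreover have "(4 * ln 4 + 8 * ln (of_int A) + 4) * sqrt (card L) \<le> (4 * 3 + 8 * ln (of_int A) + 4) * sqrt (card L)"
      using \<open>ln 4 \<le> 3\<close> by (intro mult_right_mono) auto
    ultimately show ?thesis by (simp add: algebra_simps)
  qed
  show ?thesis using \<tau>(1) main unfolding S_def g_def A_def by blast
qed

subsection \<open>Cantor sets with translated digit sets\<close>

text \<open>The transform of the uniform measure on the unit interval.\<close>

definition ramp :: "real \<Rightarrow> complex" where
  "ramp u = (if u = 0 then 1 else (cis u - 1) / (\<i> * u))"

lemma sum_cis_geometric:
  fixes N :: int
  assumes "N > 0"
  shows "cis (of_int N * u) - 1 = (cis u - 1) * (\<Sum>j\<in>{0..<N}. cis (u * of_int j))"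
proof -
  have "(\<Sum>j\<in>{0..<N}. cis (u * of_int j)) = (\<Sum>j<nat N. cis u ^ j)"
    by (rule sum.reindex_bij_witness[of _ int nat]) (auto simp: Complex.DeMoivre mult.commute)
  moreover have "cis (of_int N * u) = cis u ^ nat N"
    using assms by (simp add: Complex.DeMoivre)
  ultimately show ?thesis
    using power_diff_1_eq[of "cis u" "nat N"] by (simp add: lessThan_atLeast0)
qed

text \<open>The uniform measure on an interval is the average of the uniform measures on its
  \<open>N\<close> equal pieces. On the transform side this is a geometric sum.\<close>

lemma ramp_mult:
  fixes N :: int
  assumes "N > 0"
  shows "ramp (of_int N * u) = ramp u * ((\<Sum>j\<in>{0..<N}. cis (u * of_int j)) / of_int N)"
proof (cases "u = 0")
  case False
  then show ?thesis
    using assms by (simp add: ramp_def sum_cis_geometric[OF assms, of u])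
qed (use assms in \<open>simp add: ramp_def\<close>)

lemma norm_ramp_le_1: "norm (ramp u) \<le> 1"
  using norm_cis_diff[of u 0] by (auto simp: ramp_def norm_divide norm_mult divide_le_eq_1)

lemma norm_ramp_minus_1: "norm (ramp u - 1) \<le> \<bar>u\<bar>"
proof (cases "u = 0")
  case False
  have "norm (cis u - (1 + \<i> * u)) \<le> u\<^sup>2 / 2"
    using iexp_approx1[of u 1] by (simp add: cis_conv_exp power2_eq_square)
  moreover have "ramp u - 1 = (cis u - (1 + \<i> * u)) / (\<i> * u)"
    using False by (simp add: ramp_def diff_divide_distrib add_divide_distrib)
  ultimately have "norm (ramp u - 1) \<le> u\<^sup>2 / 2 / \<bar>u\<bar>"
    using False by (simp add: norm_divide norm_mult divide_right_mono del: divide_divide_eq_left)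
  also have "u\<^sup>2 / 2 / \<bar>u\<bar> = \<bar>u\<bar> / 2"
    using False by (simp add: power2_eq_square abs_if)
  also have "\<dots> \<le> \<bar>u\<bar>" by simp
  finally show ?thesis .
qed (simp add: ramp_def)

text \<open>Interpolation between the trivial bound 1 and the decay
  \<open>2 / \<bar>u\<bar>\<close>.\<close>

lemma norm_ramp_le_powr:
  assumes "u \<noteq> 0" "0 \<le> a" "a \<le> 1"
  shows "norm (ramp u) \<le> 2 * \<bar>u\<bar> powr (- a)"
proof (cases "\<bar>u\<bar> \<le> 1")
  case True
  have "\<bar>u\<bar> powr 0 \<le> \<bar>u\<bar> powr (- a)" using assms True by (intro powr_mono') auto
  then show ?thesis using norm_ramp_le_1[of u] assms by simp
next
  case False
  have "norm (cis u - 1) \<le> 2" using norm_triangle_ineq4[of "cis u" 1] by simp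
  then have "norm (ramp u) \<le> 2 * \<bar>u\<bar> powr (- 1)"
    using assms by (simp add: ramp_def norm_divide norm_mult powr_minus divide_right_mono
        flip: divide_inverse)
  also have "\<dots> \<le> 2 * \<bar>u\<bar> powr (- a)" using assms False by (intro mult_left_mono powr_mono) auto
  finally show ?thesis .
qed

section \<open>Trees of cells with balanced translates\<close>

locale digit_sets =
  fixes N :: "nat \<Rightarrow> int" and B :: "nat \<Rightarrow> int set"
  assumes N_ge_2: "N k \<ge> 2"
    and finite_B: "finite (B k)" and B_nonempty: "B k \<noteq> {}"
    and inj_B: "inj_on (\<lambda>b. b mod N k) (B k)"
begin

text \<open>Cells of level \<open>k\<close> have length \<open>1 / Q k\<close> and are named by the
  integer numerators of their left endpoints; \<open>P k\<close> counts the cells that are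
  kept.\<close>

definition Q :: "nat \<Rightarrow> int" where "Q k = (\<Prod>j<k. N j)"

definition P :: "nat \<Rightarrow> nat" where "P k = (\<Prod>j<k. card (B j))"

text \<open>Euclidean division by \<open>N k\<close> undoes this: the quotient is the parent cell,
  the remainder its translated digit.\<close>

definition child :: "nat \<Rightarrow> (int \<Rightarrow> int) \<Rightarrow> int \<times> int \<Rightarrow> int" where
  "child k \<tau> = (\<lambda>(d, b). d * N k + (b + \<tau> d) mod N k)"

text \<open>Divided by the number of cells, this is the change of the normalized transform caused by
  keeping the translated digits instead of all \<open>N k\<close> subcells.\<close>

definition level_error :: "nat \<Rightarrow> int set \<Rightarrow> (int \<Rightarrow> int) \<Rightarrow> real \<Rightarrow> complex" where
  "level_error k L \<tau> \<theta> = (\<Sum>d\<in>L. cis (\<theta> * of_int (d * N k)) * shift_defect (N k) (B k) (\<tau> d) \<theta>)"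

lemma N_pos: "N k > 0" using N_ge_2[of k] by simp

lemma Q_0 [simp]: "Q 0 = 1" and Q_Suc: "Q (Suc k) = Q k * N k"
  and P_0 [simp]: "P 0 = 1" and P_Suc: "P (Suc k) = P k * card (B k)"
  by (simp_all add: Q_def P_def)

lemma Q_pos: "Q k > 0" using N_pos by (simp add: Q_def prod_pos)

lemma P_pos: "P k > 0"
  using finite_B B_nonempty by (simp add: P_def prod_pos card_gt_0_iff)

lemma Q_ge_power: "2 ^ k \<le> Q k"
proof (induction k)
  case (Suc k)
  have "2 ^ k * 2 \<le> Q k * N k" using Suc N_ge_2[of k] Q_pos[of k] by (intro mult_mono) auto
  then show ?case by (simp add: Q_Suc)
qed simp

lemma child_div: "child k \<tau> (d, b) div N k = d"
  and child_mod: "child k \<tau> (d, b) mod N k = (b + \<tau> d) mod N k"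
  using N_pos[of k] by (simp_all add: child_def)

lemma inj_child: "inj_on (child k \<tau>) (L \<times> B k)"
proof (rule inj_onI)
  fix x y assume x: "x \<in> L \<times> B k" "y \<in> L \<times> B k" and eq: "child k \<tau> x = child k \<tau> y"
  obtain d b d' b' where xy: "x = (d, b)" "y = (d', b')" by (cases x, cases y)
  have d: "d = d'" using eq child_div xy by metis
  have "(b + \<tau> d) mod N k = (b' + \<tau> d) mod N k" using eq child_mod xy d by metis
  then have "b mod N k = b' mod N k" by (metis add_diff_cancel_right' mod_diff_left_eq)
  then show "x = y" using inj_B[of k] x by (auto simp: xy d inj_on_def)
qed

lemma card_child: "card (child k \<tau> ` (L \<times> B k)) = card L * card (B k)"
  by (simp add: card_image inj_child card_cartesian_product)

lemma child_subset:
  assumes "L \<subseteq> {0..<Q k}"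
  shows "child k \<tau> ` (L \<times> B k) \<subseteq> {0..<Q (Suc k)}"
proof clarify
  fix d b assume "d \<in> L"
  then have d: "0 \<le> d" "d + 1 \<le> Q k" using assms by auto
  have "(d + 1) * N k \<le> Q k * N k" using d N_pos[of k] by (intro mult_right_mono) auto
  moreover have "0 \<le> (b + \<tau> d) mod N k" "(b + \<tau> d) mod N k < N k" "0 \<le> d * N k"
    using N_pos[of k] d by auto
  ultimately show "child k \<tau> (d, b) \<in> {0..<Q (Suc k)}"
    by (simp add: child_def Q_Suc algebra_simps)
qed

text \<open>Dependent choice over the levels: the translates for level \<open>k\<close> are supplied
  by \<open>shift_choice\<close> once \<open>L k\<close> is known.\<close>

lemma exists_tree:
  "\<exists>L. L 0 = {0} \<and> (\<forall>k. L k \<subseteq> {0..<Q k} \<and> card (L k) = P k \<and>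
     (\<exists>\<tau>. L (Suc k) = child k \<tau> ` (L k \<times> B k) \<and>
       (\<forall>\<theta>. norm (level_error k (L k) \<tau> \<theta>) \<le> (8 * ln (Q (Suc k)) + 32) * sqrt (P k))))"
proof -
  \<comment> \<open>The implication from \<open>k = 0\<close> carries the root \<open>{0}\<close>
    through the dependent choice as part of the invariant.\<close>
  have "\<exists>L. \<forall>k. ((k = 0 \<longrightarrow> L k = {0}) \<and> L k \<subseteq> {0..<Q k} \<and> card (L k) = P k) \<and>
     (\<exists>\<tau>. L (Suc k) = child k \<tau> ` (L k \<times> B k) \<and>
       (\<forall>\<theta>. norm (level_error k (L k) \<tau> \<theta>) \<le> (8 * ln (Q (Suc k)) + 32) * sqrt (P k)))"
  proof (rule dependent_nat_choice)
    fix L :: "int set" and k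
    assume L: "(k = 0 \<longrightarrow> L = {0}) \<and> L \<subseteq> {0..<Q k} \<and> card L = P k"
    then have "finite L" "L \<noteq> {}" using P_pos[of k] by (auto intro: finite_subset)
    then have "\<exists>\<tau>. (\<forall>d. \<tau> d \<in> {0..<N k}) \<and>
        (\<forall>\<theta>. norm (level_error k L \<tau> \<theta>) \<le> (8 * ln (Q (Suc k)) + 32) * sqrt (card L))"
      unfolding level_error_def Q_Suc
      using L N_pos finite_B B_nonempty by (intro shift_choice) auto
    then obtain \<tau> where
      \<tau>: "\<forall>\<theta>. norm (level_error k L \<tau> \<theta>) \<le> (8 * ln (Q (Suc k)) + 32) * sqrt (P k)"
      using L by metis
    define L' where "L' = child k \<tau> ` (L \<times> B k)"
    have "L' \<subseteq> {0..<Q (Suc k)}" "card L' = P (Suc k)"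
      using child_subset[of L k \<tau>] card_child[of k \<tau> L] L by (simp_all add: L'_def P_Suc)
    then show "\<exists>L'. ((Suc k = 0 \<longrightarrow> L' = {0}) \<and> L' \<subseteq> {0..<Q (Suc k)} \<and> card L' = P (Suc k)) \<and>
       (\<exists>\<tau>. L' = child k \<tau> ` (L \<times> B k) \<and>
       (\<forall>\<theta>. norm (level_error k L \<tau> \<theta>) \<le> (8 * ln (Q (Suc k)) + 32) * sqrt (P k)))"
      using \<tau> unfolding L'_def by blast
  qed simp
  then obtain L where L: "\<And>k. k = 0 \<Longrightarrow> L k = {0}" "\<And>k. L k \<subseteq> {0..<Q k}" "\<And>k. card (L k) = P k"
    "\<And>k. \<exists>\<tau>. L (Suc k) = child k \<tau> ` (L k \<times> B k) \<and>
       (\<forall>\<theta>. norm (level_error k (L k) \<tau> \<theta>) \<le> (8 * ln (Q (Suc k)) + 32) * sqrt (P k))"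
    by metis
  show ?thesis by (intro exI[of _ L] conjI allI L refl)
qed

end

section \<open>Fourier decay along the levels of the tree\<close>

definition dft :: "int set \<Rightarrow> real \<Rightarrow> complex" where
  "dft L u = (\<Sum>d\<in>L. cis (u * of_int d)) / card L"

locale cantor_tree = digit_sets +
  fixes L :: "nat \<Rightarrow> int set" and \<tau> :: "nat \<Rightarrow> int \<Rightarrow> int"
  assumes L_0: "L 0 = {0}"
    and L_subset: "L k \<subseteq> {0..<Q k}"
    and card_L: "card (L k) = P k"
    and L_Suc: "L (Suc k) = child k (\<tau> k) ` (L k \<times> B k)"
    and error_bound: "norm (level_error k (L k) (\<tau> k) \<theta>) \<le> (8 * ln (Q (Suc k)) + 32) * sqrt (P k)"
begin

lemma finite_L: "finite (L k)" and L_nonempty: "L k \<noteq> {}"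
  using L_subset[of k] card_L[of k] P_pos[of k] by (auto intro: finite_subset)

text \<open>The subtracted product is the transform obtained by splitting every cell of level
  \<open>k\<close> into all \<open>N k\<close> subcells. What remains is one shift defect for each
  cell.\<close>

lemma dft_Suc:
  "dft (L (Suc k)) u - dft (L k) (of_int (N k) * u) * ((\<Sum>j\<in>{0..<N k}. cis (u * of_int j)) / of_int (N k))
    = level_error k (L k) (\<tau> k) u / P k"
proof -
  have *: "cis (u * of_int (d * N k)) * shift_defect (N k) (B k) (\<tau> k d) u =
      (\<Sum>b\<in>B k. cis (u * of_int (child k (\<tau> k) (d, b)))) / card (B k)
      - cis (of_int (N k) * u * of_int d) * ((\<Sum>j\<in>{0..<N k}. cis (u * of_int j)) / of_int (N k))" for d
    by (simp add: shift_defect_def child_def right_diff_distrib distrib_left sum_distrib_left mult_ac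
        flip: cis_mult)
  have "(\<Sum>d\<in>L (Suc k). cis (u * of_int d)) = (\<Sum>x\<in>L k \<times> B k. cis (u * of_int (child k (\<tau> k) x)))"
    unfolding L_Suc by (simp add: sum.reindex[OF inj_child])
  also have "\<dots> = (\<Sum>d\<in>L k. \<Sum>b\<in>B k. cis (u * of_int (child k (\<tau> k) (d, b))))"
    by (simp add: sum.cartesian_product split_def)
  finally have **: "(\<Sum>d\<in>L (Suc k). cis (u * of_int d)) = \<dots>" .
  have "level_error k (L k) (\<tau> k) u = (\<Sum>d\<in>L (Suc k). cis (u * of_int d)) / card (B k)
      - (\<Sum>d\<in>L k. cis (of_int (N k) * u * of_int d)) * ((\<Sum>j\<in>{0..<N k}. cis (u * of_int j)) / of_int (N k))"
    unfolding level_error_def * ** sum_subtractf by (simp only: sum_distrib_right sum_divide_distrib)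
  moreover have "X / of_nat (p * c) - Y / of_nat p * s = (X / of_nat c - Y * s) / of_nat p"
    for X Y s :: complex and p c :: nat
    by (simp add: diff_divide_distrib mult_ac)
  ultimately show ?thesis
    unfolding dft_def card_L P_Suc by (simp only:)
qed

text \<open>
  The transform of the uniform measure on the union of the cells of level \<open>k\<close>. In contrast to the
  discrete measure on the left endpoints it decays at infinity, so the increments can be summed.
\<close>

definition F :: "nat \<Rightarrow> real \<Rightarrow> complex" where
  "F k \<xi> = dft (L k) (\<xi> / Q k) * ramp (\<xi> / Q k)"

text \<open>\<open>ramp_mult\<close> expresses \<open>F k\<close> through the finer cells of level
  \<open>Suc k\<close>, so both transforms carry the same factor \<open>ramp\<close> and
  \<open>dft_Suc\<close> applies.\<close>

lemma F_Suc:
  "F (Suc k) \<xi> - F k \<xi> = ramp (\<xi> / Q (Suc k)) * (level_error k (L k) (\<tau> k) (\<xi> / Q (Suc k)) / P k)"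
proof -
  define u where "u = \<xi> / Q (Suc k)"
  have u: "\<xi> / Q k = of_int (N k) * u" using N_pos[of k] by (simp add: u_def Q_Suc)
  show ?thesis
    unfolding F_def u u_def[symmetric] ramp_mult[OF N_pos] dft_Suc[symmetric]
    by (simp add: algebra_simps)
qed

text \<open>Decay at scale \<open>1 / Q (Suc k)\<close> costs the factor
  \<open>Q (Suc k) powr a\<close>; cancellation among the \<open>P k\<close> cells gains
  \<open>1 / sqrt (P k)\<close>.\<close>

lemma norm_F_Suc_diff:
  assumes "\<xi> \<noteq> 0" "0 \<le> a" "a \<le> 1"
  shows "norm (F (Suc k) \<xi> - F k \<xi>)
    \<le> 2 * \<bar>\<xi>\<bar> powr (- a) * (Q (Suc k) powr a * (8 * ln (Q (Suc k)) + 32) / sqrt (P k))"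
proof -
  define u where "u = \<xi> / Q (Suc k)"
  have u: "u \<noteq> 0" "\<bar>u\<bar> powr (- a) = \<bar>\<xi>\<bar> powr (- a) * Q (Suc k) powr a"
    using assms Q_pos[of "Suc k"] by (auto simp: u_def abs_divide powr_divide powr_minus field_simps)
  have "norm (F (Suc k) \<xi> - F k \<xi>) = norm (ramp u) * (norm (level_error k (L k) (\<tau> k) u) / P k)"
    unfolding F_Suc u_def by (simp add: norm_mult norm_divide)
  also have "\<dots> \<le> 2 * \<bar>u\<bar> powr (- a) * ((8 * ln (Q (Suc k)) + 32) * sqrt (P k) / P k)"
    using u assms by (intro mult_mono norm_ramp_le_powr divide_right_mono error_bound) auto
  also have "(8 * ln (Q (Suc k)) + 32) * sqrt (P k) / P k = (8 * ln (Q (Suc k)) + 32) / sqrt (P k)"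
    by (simp add: real_div_sqrt flip: divide_divide_eq_right)
  finally show ?thesis by (simp add: u mult_ac)
qed

text \<open>Telescoping from \<open>F 0\<close>, which is \<open>ramp\<close> itself. The bound is
  uniform in \<open>k\<close> and therefore survives the limit.\<close>

lemma norm_F_le:
  assumes "\<xi> \<noteq> 0" "0 \<le> a" "a \<le> 1"
    and sum: "summable (\<lambda>k. Q (Suc k) powr a * (8 * ln (Q (Suc k)) + 32) / sqrt (P k))"
  shows "norm (F k \<xi>) \<le> 2 * \<bar>\<xi>\<bar> powr (- a) *
    (1 + (\<Sum>k. Q (Suc k) powr a * (8 * ln (Q (Suc k)) + 32) / sqrt (P k)))"
proof -
  define h where "h k = Q (Suc k) powr a * (8 * ln (Q (Suc k)) + 32) / sqrt (P k)" for k
  have h: "h k \<ge> 0" for k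
    using Q_pos[of "Suc k"] by (auto simp: h_def)
  have "F k \<xi> = F 0 \<xi> + (\<Sum>j<k. F (Suc j) \<xi> - F j \<xi>)"
    using sum_lessThan_telescope[of "\<lambda>j. F j \<xi>" k] by simp
  also have "norm \<dots> \<le> norm (F 0 \<xi>) + (\<Sum>j<k. norm (F (Suc j) \<xi> - F j \<xi>))"
    by (intro order_trans[OF norm_triangle_ineq] add_left_mono norm_sum)
  also have "\<dots> \<le> 2 * \<bar>\<xi>\<bar> powr (- a) + (\<Sum>j<k. 2 * \<bar>\<xi>\<bar> powr (- a) * h j)"
  proof (intro add_mono sum_mono)
    show "norm (F 0 \<xi>) \<le> 2 * \<bar>\<xi>\<bar> powr (- a)"
      using norm_ramp_le_powr assms by (simp add: F_def L_0 dft_def)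
  qed (use norm_F_Suc_diff assms in \<open>simp add: h_def\<close>)
  also have "\<dots> = 2 * \<bar>\<xi>\<bar> powr (- a) * (1 + (\<Sum>j<k. h j))"
    by (simp add: distrib_left flip: sum_distrib_left)
  also have "\<dots> \<le> 2 * \<bar>\<xi>\<bar> powr (- a) * (1 + suminf h)"
    using sum h by (intro mult_left_mono add_left_mono sum_le_suminf) (auto simp: h_def)
  finally show ?thesis unfolding h_def .
qed

end

subsection \<open>Rigidity of the Cantor set\<close>

text \<open>The integer \<open>c\<close> is a carry between digit positions. The case
  \<open>v = 1\<close> is included because it yields injectivity modulo \<open>N\<close>.\<close>

definition rigid :: "nat \<Rightarrow> int \<Rightarrow> int set \<Rightarrow> bool" where
  "rigid M N B \<longleftrightarrow> (\<forall>v (m :: nat \<Rightarrow> nat) (b :: nat \<Rightarrow> int) c.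
     (\<forall>i\<le>v. 1 \<le> m i) \<longrightarrow> m 0 = (\<Sum>i=1..v. m i) \<longrightarrow> m 0 \<le> M \<longrightarrow>
     (\<forall>i\<le>v. b i \<in> B) \<longrightarrow> \<bar>c\<bar> \<le> int M \<longrightarrow>
     N dvd int (m 0) * b 0 - (\<Sum>i=1..v. int (m i) * b i) - c \<longrightarrow> (\<forall>i\<le>v. b i = b 0))"

lemma rigidD:
  fixes m :: "nat \<Rightarrow> nat" and b :: "nat \<Rightarrow> int"
  assumes "rigid M N B" "\<And>i. i \<le> v \<Longrightarrow> 1 \<le> m i" "m 0 = (\<Sum>i=1..v. m i)" "m 0 \<le> M"
    "\<And>i. i \<le> v \<Longrightarrow> b i \<in> B" "\<bar>c\<bar> \<le> int M"
    "N dvd int (m 0) * b 0 - (\<Sum>i=1..v. int (m i) * b i) - c" "i \<le> v"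
  shows "b i = b 0"
  using assms unfolding rigid_def by blast

lemma rigid_imp_inj_on_mod:
  assumes "rigid M N B" "M \<ge> 1"
  shows "inj_on (\<lambda>b. b mod N) B"
proof (rule inj_onI)
  fix x y assume xy: "x \<in> B" "y \<in> B" "x mod N = y mod N"
  define b where "b = (\<lambda>i::nat. if i = 0 then x else y)"
  have "b 1 = b 0"
    by (rule rigidD[where m = "\<lambda>_. 1" and v = 1 and c = 0, OF assms(1)])
      (use assms xy in \<open>auto simp: b_def mod_eq_dvd_iff\<close>)
  then show "x = y" by (simp add: b_def)
qed

context cantor_tree
begin

definition level_set :: "nat \<Rightarrow> real set" where
  "level_set k = (\<Union>d\<in>L k. {of_int d / Q k .. (of_int d + 1) / Q k})"

definition cantor_set :: "real set" where
  "cantor_set = (\<Inter>k. level_set k)"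

lemma in_cell_iff:
  fixes x :: real
  shows "x \<in> {of_int d / Q k .. (of_int d + 1) / Q k} \<longleftrightarrow> of_int d \<le> x * Q k \<and> x * Q k \<le> of_int d + 1"
  using Q_pos[of k] by (simp add: field_simps)

lemma parent_in_L:
  assumes "e \<in> L (Suc k)"
  shows "e div N k \<in> L k"
  using assms child_div unfolding L_Suc by auto

lemma level_set_Suc: "level_set (Suc k) \<subseteq> level_set k"
proof
  fix x assume "x \<in> level_set (Suc k)"
  then obtain e where e: "e \<in> L (Suc k)" "of_int e \<le> x * Q k * N k" "x * Q k * N k \<le> of_int e + 1"
    unfolding level_set_def UN_iff in_cell_iff by (auto simp: Q_Suc mult_ac)
  define d where "d = e div N k"
  have "d * N k \<le> e" "e + 1 \<le> (d + 1) * N k"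
    using N_pos[of k] pos_mod_bound[of "N k" e] minus_div_mult_eq_mod[of e "N k"] pos_mod_sign[of "N k" e]
    unfolding d_def distrib_right by linarith+
  then have "real_of_int (d * N k) \<le> e" "real_of_int (e + 1) \<le> real_of_int ((d + 1) * N k)"
    by (simp_all only: of_int_le_iff)
  then have "real_of_int d * N k \<le> x * Q k * N k" "x * Q k * N k \<le> (real_of_int d + 1) * N k"
    using e by simp_all
  then have "of_int d \<le> x * Q k" "x * Q k \<le> of_int d + 1"
    using N_pos[of k] by (simp_all only: mult_le_cancel_right_pos of_int_0_less_iff)
  then show "x \<in> level_set k"
    unfolding level_set_def UN_iff in_cell_iff using parent_in_L[OF e(1)] d_def by blast
qed

lemma level_set_antimono: "j \<le> k \<Longrightarrow> level_set k \<subseteq> level_set j"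
  by (rule lift_Suc_antimono_le[of level_set]) (simp_all add: level_set_Suc)

lemma closed_level_set: "closed (level_set k)"
  unfolding level_set_def using finite_L by (intro closed_UN) auto

lemma closed_cantor_set: "closed cantor_set"
  unfolding cantor_set_def using closed_level_set by auto

lemma cantor_set_subset: "cantor_set \<subseteq> {0..1}"
proof -
  have "cantor_set \<subseteq> level_set 0" unfolding cantor_set_def by blast
  also have "level_set 0 = {0..1}" by (simp add: level_set_def L_0)
  finally show ?thesis .
qed

text \<open>
  A point that is an endpoint of cells has two candidate addresses, given by the floor and by
  the ceiling minus one; each of them is coherent across all levels.
\<close>

lemma cantor_set_address:
  assumes "x \<in> cantor_set"
  shows "\<exists>\<delta>. \<forall>k. \<delta> k \<in> L k \<and> \<delta> (Suc k) div N k = \<delta> k \<and> of_int (\<delta> k) \<le> x * Q k \<and> x * Q k \<le> of_int (\<delta> k) + 1"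
proof -
  define a where "a k = \<lfloor>x * Q k\<rfloor>" for k
  define b where "b k = \<lceil>x * Q k\<rceil> - 1" for k
  have div_eq: "e div N k = c" if "c * N k \<le> e" "e < c * N k + N k" for e c k
    using that by (intro int_div_pos_eq[of _ _ _ "e - c * N k"]) auto
  have a: "a (Suc k) div N k = a k" for k
  proof (rule div_eq)
    have y: "real_of_int (a k) \<le> x * Q k" "x * Q k < real_of_int (a k) + 1" unfolding a_def by linarith+
    have "real_of_int (a k) * N k \<le> x * Q k * N k" "x * Q k * N k < (real_of_int (a k) + 1) * N k"
      using y N_pos[of k] by (intro mult_right_mono mult_strict_right_mono; simp)+
    then have "real_of_int (a k * N k) \<le> x * Q (Suc k)" "x * Q (Suc k) < real_of_int (a k * N k + N k)"
      by (simp_all add: Q_Suc algebra_simps)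
    then show "a k * N k \<le> a (Suc k)" "a (Suc k) < a k * N k + N k"
      unfolding a_def[of "Suc k"] by (simp_all only: le_floor_iff floor_less_iff)
  qed
  have b: "b (Suc k) div N k = b k" for k
  proof (rule div_eq)
    have y: "real_of_int (b k) < x * Q k" "x * Q k \<le> real_of_int (b k) + 1" unfolding b_def by linarith+
    have "real_of_int (b k) * N k < x * Q k * N k" "x * Q k * N k \<le> (real_of_int (b k) + 1) * N k"
      using y N_pos[of k] by (intro mult_right_mono mult_strict_right_mono; simp)+
    then have "real_of_int (b k * N k) < x * Q (Suc k)" "x * Q (Suc k) \<le> real_of_int (b k * N k + N k)"
      by (simp_all add: Q_Suc algebra_simps)
    then have "b k * N k < \<lceil>x * Q (Suc k)\<rceil>" "\<lceil>x * Q (Suc k)\<rceil> \<le> b k * N k + N k"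
      by (simp_all only: ceiling_le_iff less_ceiling_iff)
    then show "b k * N k \<le> b (Suc k)" "b (Suc k) < b k * N k + N k"
      unfolding b_def[of "Suc k"] by simp_all
  qed
  have ab: "a k \<in> L k \<or> b k \<in> L k" for k
  proof -
    have "x \<in> level_set k" using assms unfolding cantor_set_def by blast
    then obtain d where d: "d \<in> L k" "of_int d \<le> x * Q k" "x * Q k \<le> of_int d + 1"
      unfolding level_set_def UN_iff in_cell_iff by blast
    have "a k = d \<or> b k = d" unfolding a_def b_def using d(2,3) by linarith
    then show ?thesis using d(1) by blast
  qed
  \<comment> \<open>Membership in the tree passes from a cell to its ancestors.\<close>
  have down: "c j \<in> L j" if "c k \<in> L k" "j \<le> k" "\<And>k. c (Suc k) div N k = c k" for c j k
    using that(2,1) by (induction rule: inc_induct) (metis parent_in_L that(3))+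
  \<comment> \<open>If each address left the tree at some level, both would be outside it at the
    larger of the two levels, contrary to \<open>ab\<close>.\<close>
  have "(\<forall>k. a k \<in> L k) \<or> (\<forall>k. b k \<in> L k)"
  proof (rule ccontr)
    assume "\<not> ?thesis"
    then obtain i j where "a i \<notin> L i" "b j \<notin> L j" by blast
    then show False
      using ab[of "max i j"] down[of a "max i j" i] down[of b "max i j" j] a b by auto
  qed
  moreover have "real_of_int (a k) \<le> x * Q k \<and> x * Q k \<le> of_int (a k) + 1" for k
    unfolding a_def by linarith
  moreover have "real_of_int (b k) \<le> x * Q k \<and> x * Q k \<le> of_int (b k) + 1" for k
    unfolding b_def by linarith
  ultimately show ?thesis using a b by blast
qed

lemma eq_if_same_address:
  fixes x y :: real
  assumes "\<And>k. of_int (\<delta> k) \<le> x * Q k \<and> x * Q k \<le> of_int (\<delta> k) + 1"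
    and "\<And>k. of_int (\<delta> k) \<le> y * Q k \<and> y * Q k \<le> of_int (\<delta> k) + 1"
  shows "x = y"
proof (rule ccontr)
  assume "x \<noteq> y"
  then obtain k :: nat where k: "1 / \<bar>x - y\<bar> < 2 ^ k"
    using real_arch_pow[of 2 "1 / \<bar>x - y\<bar>"] by auto
  have "2 ^ k \<le> real_of_int (Q k)"
    using Q_ge_power[of k] by (metis of_int_le_iff of_int_numeral of_int_power)
  then have "1 / \<bar>x - y\<bar> < Q k" using k by linarith
  then have "1 < \<bar>x - y\<bar> * Q k" using \<open>x \<noteq> y\<close> by (simp add: field_simps)
  also have "\<dots> = \<bar>x * Q k - y * Q k\<bar>" using Q_pos[of k] by (simp add: abs_mult flip: left_diff_distrib)
  also have "\<dots> \<le> 1" using assms(1)[of k] assms(2)[of k] by linarith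
  finally show False by simp
qed

text \<open>
  At the first level where the addresses of the \<open>x i\<close> differ, the digits satisfy the equation
  up to a carry that is bounded by the coefficient \<open>m 0\<close>.
\<close>

lemma cantor_set_rigid:
  fixes m :: "nat \<Rightarrow> nat" and x :: "nat \<Rightarrow> real"
  assumes rigid: "\<And>k. rigid M (N k) (B k)"
    and m: "\<And>i. i \<le> v \<Longrightarrow> 1 \<le> m i" "m 0 = (\<Sum>i=1..v. m i)" "m 0 \<le> M"
    and x: "\<And>i. i \<le> v \<Longrightarrow> x i \<in> cantor_set"
    and zero: "m 0 * x 0 = (\<Sum>i=1..v. m i * x i)"
    and i: "i \<le> v"
  shows "x i = x 0"
proof -
  have "\<forall>i. \<exists>\<delta>. i \<le> v \<longrightarrow> (\<forall>k. \<delta> k \<in> L k \<and> \<delta> (Suc k) div N k = \<delta> k \<and>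
      of_int (\<delta> k) \<le> x i * Q k \<and> x i * Q k \<le> of_int (\<delta> k) + 1)"
    using cantor_set_address x by blast
  then obtain \<delta> where \<delta>: "\<And>i k. i \<le> v \<Longrightarrow> \<delta> i k \<in> L k"
    "\<And>i k. i \<le> v \<Longrightarrow> \<delta> i (Suc k) div N k = \<delta> i k"
    "\<And>i k. i \<le> v \<Longrightarrow> of_int (\<delta> i k) \<le> x i * Q k \<and> x i * Q k \<le> of_int (\<delta> i k) + 1"
    by metis
  have "\<forall>i\<le>v. \<delta> i k = \<delta> 0 k" for k
  proof (induction k)
    case 0
    then show ?case using \<delta>(1)[of _ 0] by (simp add: L_0)
  next
    case (Suc k)
    define d where "d = \<delta> 0 k"
    have "\<forall>i. \<exists>b. i \<le> v \<longrightarrow> b \<in> B k \<and> \<delta> i (Suc k) = child k (\<tau> k) (d, b)"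
    proof (intro allI)
      fix i
      show "\<exists>b. i \<le> v \<longrightarrow> b \<in> B k \<and> \<delta> i (Suc k) = child k (\<tau> k) (d, b)"
      proof (cases "i \<le> v")
        case True
        obtain d' b where b: "b \<in> B k" "\<delta> i (Suc k) = child k (\<tau> k) (d', b)"
          using \<delta>(1)[OF True, of "Suc k"] unfolding L_Suc by auto
        then have "d' = d" using \<delta>(2)[OF True, of k] child_div Suc True d_def by metis
        then show ?thesis using b by blast
      qed simp
    qed
    then obtain b where b: "\<And>i. i \<le> v \<Longrightarrow> b i \<in> B k"
      "\<And>i. i \<le> v \<Longrightarrow> \<delta> i (Suc k) = child k (\<tau> k) (d, b i)" by metis
    \<comment> \<open>Replacing the points by the integer addresses spoils the equation by
      \<open>c\<close>. As the points solve it exactly, \<open>c\<close> is a difference of two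
      weighted sums of offsets \<open>\<rho> i\<close>, both between 0 and
      \<open>m 0\<close>.\<close>
    define c where "c = int (m 0) * \<delta> 0 (Suc k) - (\<Sum>i=1..v. int (m i) * \<delta> i (Suc k))"
    define \<rho> where "\<rho> i = x i * Q (Suc k) - of_int (\<delta> i (Suc k))" for i
    have \<rho>: "0 \<le> \<rho> i" "\<rho> i \<le> 1" if "i \<le> v" for i
      using \<delta>(3)[OF that, of "Suc k"] unfolding \<rho>_def by linarith+
    have "real_of_int c = (\<Sum>i=1..v. m i * \<rho> i) - m 0 * \<rho> 0"
    proof -
      have "(\<Sum>i=1..v. m i * \<rho> i) - m 0 * \<rho> 0 =
          ((\<Sum>i=1..v. m i * x i) - m 0 * x 0) * Q (Suc k) + real_of_int c"
        by (simp add: \<rho>_def c_def algebra_simps sum_subtractf sum_distrib_left sum_distrib_right)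
      then show ?thesis using zero by simp
    qed
    moreover have "0 \<le> (\<Sum>i=1..v. m i * \<rho> i)" "0 \<le> m 0 * \<rho> 0"
      using \<rho> by (auto intro!: sum_nonneg mult_nonneg_nonneg)
    moreover have "(\<Sum>i=1..v. m i * \<rho> i) \<le> m 0" "m 0 * \<rho> 0 \<le> m 0"
    proof -
      have "(\<Sum>i=1..v. m i * \<rho> i) \<le> (\<Sum>i=1..v. real (m i))"
        using \<rho> by (intro sum_mono) (auto intro!: mult_left_le)
      then show "(\<Sum>i=1..v. m i * \<rho> i) \<le> m 0" by (simp add: m(2))
      show "m 0 * \<rho> 0 \<le> m 0" using \<rho>[of 0] by (auto intro!: mult_left_le)
    qed
    ultimately have c: "\<bar>c\<bar> \<le> int M" using m(3) by linarith
    \<comment> \<open>These quotients are what reduction modulo \<open>N k\<close> discards. The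
      common part \<open>d * N k + \<tau> k d\<close> cancels because the weights sum to
      \<open>m 0\<close>, leaving an equation for the untranslated digits modulo
      \<open>N k\<close>.\<close>
    define r where "r i = (b i + \<tau> k d) div N k" for i
    have \<delta>_b: "\<delta> i (Suc k) = d * N k + (b i + \<tau> k d - r i * N k)" if "i \<le> v" for i
      using b(2)[OF that] by (simp add: child_def r_def minus_div_mult_eq_mod)
    have m_sum: "(\<Sum>i=1..v. int (m i) * y) = int (m 0) * y" for y
      by (simp add: m(2) sum_distrib_right)
    have "(\<Sum>i=1..v. int (m i) * \<delta> i (Suc k)) =
        (\<Sum>i=1..v. int (m i) * (d * N k + \<tau> k d) + int (m i) * b i - int (m i) * r i * N k)"
      by (intro sum.cong) (auto simp: \<delta>_b algebra_simps)
    also have "\<dots> = int (m 0) * (d * N k + \<tau> k d) + (\<Sum>i=1..v. int (m i) * b i)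
        - (\<Sum>i=1..v. int (m i) * r i) * N k"
      by (simp only: sum_subtractf sum.distrib m_sum sum_distrib_right)
    finally have "c = int (m 0) * b 0 - (\<Sum>i=1..v. int (m i) * b i)
        + ((\<Sum>i=1..v. int (m i) * r i) - int (m 0) * r 0) * N k"
      by (simp add: c_def \<delta>_b algebra_simps)
    then have "N k dvd int (m 0) * b 0 - (\<Sum>i=1..v. int (m i) * b i) - c" by simp
    then have "b i = b 0" if "i \<le> v" for i
      using rigidD[OF rigid[of k], of v m b c i] m b(1) c that by blast
    then show ?case using b(2) by (metis le0)
  qed
  then show ?thesis
    using eq_if_same_address[of "\<delta> 0" "x i" "x 0"] \<delta>(3) i by (metis le0)
qed

end

subsection \<open>The limit measure\<close>

context cantor_tree
begin

definition level_measure :: "nat \<Rightarrow> real measure" where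
  "level_measure k = distr (measure_pmf (pmf_of_set (L k))) borel (\<lambda>d. of_int d / Q k)"

lemma real_distribution_level_measure: "real_distribution (level_measure k)"
  unfolding level_measure_def
  by (intro prob_space.real_distribution_distr prob_space_measure_pmf) simp

lemma integral_level_measure:
  fixes f :: "real \<Rightarrow> 'a::{banach, second_countable_topology}"
  assumes "f \<in> borel_measurable borel"
  shows "integral\<^sup>L (level_measure k) f = (\<Sum>d\<in>L k. f (real_of_int d / real_of_int (Q k))) /\<^sub>R card (L k)"
proof -
  have "integral\<^sup>L (level_measure k) f = (\<integral>d. f (real_of_int d / real_of_int (Q k)) \<partial>pmf_of_set (L k))"
    unfolding level_measure_def using assms by (subst integral_distr) auto
  also have "\<dots> = (\<Sum>d\<in>L k. pmf (pmf_of_set (L k)) d *\<^sub>R f (real_of_int d / real_of_int (Q k)))"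
    using finite_L L_nonempty by (intro integral_measure_pmf) auto
  also have "\<dots> = (\<Sum>d\<in>L k. f (real_of_int d / real_of_int (Q k))) /\<^sub>R card (L k)"
    using finite_L L_nonempty by (simp add: scaleR_sum_right inverse_eq_divide)
  finally show ?thesis .
qed

lemma char_level_measure: "char (level_measure k) \<xi> = dft (L k) (\<xi> / Q k)"
proof -
  have "char (level_measure k) \<xi> = (\<Sum>d\<in>L k. iexp (\<xi> * (of_int d / Q k))) /\<^sub>R card (L k)"
    unfolding char_def by (subst integral_level_measure) auto
  then show ?thesis
    by (simp add: dft_def cis_conv_exp scaleR_conv_of_real divide_inverse mult_ac)
qed

lemma left_endpoint_in_level_set:
  assumes "d \<in> L k" "j \<le> k"
  shows "of_int d / Q k \<in> level_set j"
proof -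
  have "of_int d / Q k \<in> {of_int d / Q k .. (of_int d + 1) / Q k}"
    using Q_pos[of k] by (simp add: divide_right_mono)
  then have "of_int d / Q k \<in> level_set k" using assms unfolding level_set_def by blast
  then show ?thesis using level_set_antimono[OF assms(2)] by blast
qed

lemma tight_level_measure: "tight level_measure"
  unfolding tight_def
proof (intro conjI allI impI real_distribution_level_measure)
  fix \<epsilon> :: real assume "\<epsilon> > 0"
  \<comment> \<open>Tightness uses intervals open on the left, and 0 may be a left endpoint of a
    cell.\<close>
  have "measure (level_measure k) {-1<..1} = 1" for k
  proof -
    have "integral\<^sup>L (level_measure k) (indicator {-1<..1} :: real \<Rightarrow> real) = 1"
    proof (subst integral_level_measure)
      have "of_int d / Q k \<in> {-1<..1}" if "d \<in> L k" for d
        using left_endpoint_in_level_set[OF that, of 0] by (auto simp: level_set_def L_0)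
      then show "(\<Sum>d\<in>L k. indicator {-1<..1} (of_int d / Q k)) /\<^sub>R card (L k) = (1::real)"
        using finite_L L_nonempty by simp
    qed simp
    then show ?thesis
      by (simp add: level_measure_def)
  qed
  then show "\<exists>a b. a < b \<and> (\<forall>k. 1 - \<epsilon> < measure (level_measure k) {a<..b})"
    using \<open>\<epsilon> > 0\<close> by (intro exI[of _ "-1"] exI[of _ 1]) simp
qed

text \<open>Hence the discrete level measures and their smoothed versions \<open>F\<close> have the
  same limiting transform.\<close>

lemma ramp_tendsto_1: "(\<lambda>k. ramp (\<xi> / Q k)) \<longlonglongrightarrow> 1"
proof (rule LIM_zero_cancel, rule Lim_null_comparison)
  have "norm (ramp (\<xi> / Q k) - 1) \<le> \<bar>\<xi>\<bar> * (1 / 2) ^ k" for k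
  proof -
    have q: "2 ^ k \<le> real_of_int (Q k)"
      using Q_ge_power[of k] by (metis of_int_le_iff of_int_numeral of_int_power)
    have "\<bar>\<xi>\<bar> / real_of_int (Q k) \<le> \<bar>\<xi>\<bar> / 2 ^ k"
      by (intro frac_le q) auto
    then have "\<bar>\<xi> / Q k\<bar> \<le> \<bar>\<xi>\<bar> / 2 ^ k" using Q_pos[of k] by (simp add: abs_divide)
    then show ?thesis using norm_ramp_minus_1[of "\<xi> / Q k"] by (simp add: power_divide)
  qed
  then show "\<forall>\<^sub>F k in sequentially. norm (ramp (\<xi> / Q k) - 1) \<le> \<bar>\<xi>\<bar> * (1 / 2) ^ k" by simp
  show "(\<lambda>k. \<bar>\<xi>\<bar> * (1 / 2) ^ k) \<longlonglongrightarrow> 0" by real_asymp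
qed

text \<open>A weak limit of the discrete level measures along a subsequence, obtained by tightness.
  Decay follows from Levy continuity and the uniform bound on \<open>F\<close>. One measure serves
  all exponents \<open>a\<close>.\<close>

lemma exists_cantor_measure:
  "\<exists>\<mu>. real_distribution \<mu> \<and> measure_support \<mu> \<subseteq> cantor_set \<and>
    (\<forall>a. 0 \<le> a \<longrightarrow> a \<le> 1 \<longrightarrow>
      summable (\<lambda>k. Q (Suc k) powr a * (8 * ln (Q (Suc k)) + 32) / sqrt (P k)) \<longrightarrow>
      (\<exists>C>0. \<forall>\<xi>. norm (char \<mu> \<xi>) \<le> C * (1 + \<bar>\<xi>\<bar>) powr (- a)))"
proof -
  obtain r \<mu> where r: "strict_mono (r :: nat \<Rightarrow> nat)" and \<mu>: "real_distribution \<mu>"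
    and weak: "weak_conv_m (level_measure \<circ> id \<circ> r) \<mu>"
    using tight_imp_convergent_subsubsequence[OF tight_level_measure, of id] strict_mono_id by blast
  interpret real_distribution \<mu> by (rule \<mu>)
  have weak': "weak_conv_m (\<lambda>j. level_measure (r j)) \<mu>"
    using weak by (simp add: o_def)
  have "measure_support \<mu> \<subseteq> cantor_set"
  proof
    fix x assume x: "x \<in> measure_support \<mu>"
    show "x \<in> cantor_set"
    proof (rule ccontr)
      assume "x \<notin> cantor_set"
      then obtain k where "x \<in> - level_set k" unfolding cantor_set_def by blast
      moreover have "open (- level_set k)" using closed_level_set by auto
      ultimately obtain e where e: "e > 0" "ball x e \<subseteq> - level_set k" by (meson open_contains_ball)
      \<comment> \<open>A tent function positive exactly on the ball. All level measures from level
        \<open>k\<close> on live inside \<open>level_set k\<close> and integrate it to 0.\<close>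
      define f where "f y = max 0 (e - \<bar>y - x\<bar>)" for y
      have f: "continuous_on UNIV f" unfolding f_def by (intro continuous_intros)
      have f_meas [measurable]: "f \<in> borel_measurable borel"
        using f by (rule borel_measurable_continuous_onI)
      have f_bound: "norm (f y) \<le> e" for y using e by (auto simp: f_def)
      have f_pos: "f y > 0 \<longleftrightarrow> y \<in> ball x e" for y by (auto simp: f_def dist_real_def)
      have "(\<lambda>j. integral\<^sup>L (level_measure (r j)) f) \<longlonglongrightarrow> integral\<^sup>L \<mu> f"
        using f f_bound
        by (intro weak_conv_imp_integral_bdd_continuous_conv[OF real_distribution_level_measure \<mu> weak'])
          (auto simp: continuous_on_eq_continuous_at)
      moreover have "integral\<^sup>L (level_measure (r j)) f = 0" if "j \<ge> k" for j
      proof -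
        have "k \<le> r j" using that seq_suble[OF r, of j] by linarith
        then have "f (of_int d / Q (r j)) = 0" if "d \<in> L (r j)" for d
          using left_endpoint_in_level_set[OF that, of k] e(2) f_pos[of "of_int d / Q (r j)"]
          by (auto simp: f_def)
        then show ?thesis by (simp add: integral_level_measure)
      qed
      then have "(\<lambda>j. integral\<^sup>L (level_measure (r j)) f) \<longlonglongrightarrow> 0"
        by (intro tendsto_eventually eventually_sequentiallyI[of k])
      ultimately have "integral\<^sup>L \<mu> f = 0" by (rule LIMSEQ_unique)
      moreover have "integrable \<mu> f"
        using f_bound by (intro integrable_const_bound[where B = e]) auto
      ultimately have "AE y in \<mu>. f y = 0"
        by (subst integral_nonneg_eq_0_iff_AE[symmetric]) (auto simp: f_def)
      then have "AE y in \<mu>. y \<notin> ball x e"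
        by eventually_elim (metis f_pos less_irrefl)
      then have "emeasure \<mu> (ball x e) = 0"
        by (subst (asm) AE_iff_measurable[of "ball x e"]) auto
      then show False using x e(1) unfolding measure_support_def
        by (metis (no_types, lifting) centre_in_ball less_irrefl mem_Collect_eq open_ball)
    qed
  qed
  moreover have "\<exists>C>0. \<forall>\<xi>. norm (char \<mu> \<xi>) \<le> C * (1 + \<bar>\<xi>\<bar>) powr (- a)"
    if a: "0 \<le> a" "a \<le> 1"
      and sum: "summable (\<lambda>k. Q (Suc k) powr a * (8 * ln (Q (Suc k)) + 32) / sqrt (P k))" for a
  proof -
    define S where "S = 1 + (\<Sum>k. Q (Suc k) powr a * (8 * ln (Q (Suc k)) + 32) / sqrt (P k))"
    have S: "S \<ge> 1"
    proof -
      have "1 \<le> real_of_int (Q k)" for k using Q_pos[of k] by simp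
      then show ?thesis unfolding S_def using sum by (auto intro!: suminf_nonneg add_nonneg_nonneg)
    qed
    have bound: "norm (char \<mu> \<xi>) \<le> 2 * S * \<bar>\<xi>\<bar> powr (- a)" if "\<xi> \<noteq> 0" for \<xi>
    proof -
      have "(\<lambda>j. char (level_measure (r j)) \<xi>) \<longlonglongrightarrow> char \<mu> \<xi>"
        using real_distribution_level_measure \<mu> weak' by (rule levy_continuity1)
      moreover have "(\<lambda>j. ramp (\<xi> / Q (r j))) \<longlonglongrightarrow> 1"
        using LIMSEQ_subseq_LIMSEQ[OF ramp_tendsto_1 r] by (simp add: o_def)
      ultimately have "(\<lambda>j. F (r j) \<xi>) \<longlonglongrightarrow> char \<mu> \<xi> * 1"
        unfolding F_def char_level_measure by (rule tendsto_mult)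
      then have "(\<lambda>j. norm (F (r j) \<xi>)) \<longlonglongrightarrow> norm (char \<mu> \<xi>)" by (simp add: tendsto_norm)
      moreover have "norm (F k \<xi>) \<le> 2 * S * \<bar>\<xi>\<bar> powr (- a)" for k
        using norm_F_le[OF that a sum, of k] unfolding S_def by (simp only: mult_ac)
      ultimately show ?thesis by (intro LIMSEQ_le_const2) auto
    qed
    \<comment> \<open>For small frequencies the trivial bound 1 suffices; for the others
      \<open>1 + \<bar>\<xi>\<bar>\<close> is at most \<open>2 * \<bar>\<xi>\<bar>\<close>, which
      costs another factor 2.\<close>
    have "norm (char \<mu> \<xi>) \<le> 4 * S * (1 + \<bar>\<xi>\<bar>) powr (- a)" for \<xi>
    proof (cases "\<bar>\<xi>\<bar> \<le> 1")
      case True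
      have "(1 + \<bar>\<xi>\<bar>) powr a \<le> 2 powr 1"
        using True a by (intro powr_mono_both) auto
      then have "1 \<le> 2 * (1 + \<bar>\<xi>\<bar>) powr (- a)"
        by (simp add: powr_minus field_simps)
      also have "\<dots> \<le> 4 * S * (1 + \<bar>\<xi>\<bar>) powr (- a)"
        using S by (intro mult_right_mono) auto
      finally show ?thesis using cmod_char_le_1[of \<xi>] by linarith
    next
      case False
      have "(1 + \<bar>\<xi>\<bar>) powr a \<le> (2 * \<bar>\<xi>\<bar>) powr a" using False a by (intro powr_mono2) auto
      also have "\<dots> = 2 powr a * \<bar>\<xi>\<bar> powr a" by (simp add: powr_mult)
      also have "\<dots> \<le> 2 powr 1 * \<bar>\<xi>\<bar> powr a"
        using a by (intro mult_right_mono powr_mono) auto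
      finally have "\<bar>\<xi>\<bar> powr (- a) \<le> 2 * (1 + \<bar>\<xi>\<bar>) powr (- a)"
        using False by (simp add: powr_minus field_simps)
      then have "2 * S * \<bar>\<xi>\<bar> powr (- a) \<le> 2 * S * (2 * (1 + \<bar>\<xi>\<bar>) powr (- a))"
        using S by (intro mult_left_mono) auto
      moreover have "\<xi> \<noteq> 0" using False by auto
      ultimately have "norm (char \<mu> \<xi>) \<le> 2 * S * (2 * (1 + \<bar>\<xi>\<bar>) powr (- a))"
        using bound by (meson order_trans)
      then show ?thesis by simp
    qed
    then show ?thesis using S by (intro exI[of _ "4 * S"]) auto
  qed
  ultimately show ?thesis using \<mu> by blast
qed

lemma fourier_dim_cantor_set:
  assumes sum: "\<And>a. 0 \<le> a \<Longrightarrow> a < 1 / 2 \<Longrightarrow>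
    summable (\<lambda>k. Q (Suc k) powr a * (8 * ln (Q (Suc k)) + 32) / sqrt (P k))"
  shows "fourier_dim cantor_set = 1"
proof (rule antisym)
  show "fourier_dim cantor_set \<le> 1"
    unfolding fourier_dim_def by (intro SUP_least) auto
  obtain \<mu> where *: "real_distribution \<mu> \<and> measure_support \<mu> \<subseteq> cantor_set \<and>
    (\<forall>a. 0 \<le> a \<longrightarrow> a \<le> 1 \<longrightarrow>
      summable (\<lambda>k. Q (Suc k) powr a * (8 * ln (Q (Suc k)) + 32) / sqrt (P k)) \<longrightarrow>
      (\<exists>C>0. \<forall>\<xi>. norm (char \<mu> \<xi>) \<le> C * (1 + \<bar>\<xi>\<bar>) powr (- a)))"
    using exists_cantor_measure by (rule exE)
  note \<mu> = conjunct1[OF *] conjunct1[OF conjunct2[OF *]]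
  have decay: "\<exists>C>0. \<forall>\<xi>. norm (char \<mu> \<xi>) \<le> C * (1 + \<bar>\<xi>\<bar>) powr (- a)"
    if "0 \<le> a" "a < 1 / 2" for a
    by (rule conjunct2[OF conjunct2[OF *], rule_format, OF that(1) _ sum[OF that]]) (use that in simp)
  \<comment> \<open>The opposite sign convention is harmless since the decay bound is even in the
    frequency.\<close>
  have transform: "fourier_transform \<mu> \<xi> = char \<mu> (- \<xi>)" for \<xi>
    unfolding fourier_transform_def char_def by (simp add: mult.commute)
  have dim: "ereal \<beta> \<le> fourier_dim cantor_set" if \<beta>: "0 \<le> \<beta>" "\<beta> < 1" for \<beta>
  proof -
    obtain C where C: "C > 0" "\<And>\<xi>. norm (char \<mu> \<xi>) \<le> C * (1 + \<bar>\<xi>\<bar>) powr (- (\<beta> / 2))"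
      using decay[of "\<beta> / 2"] \<beta> by auto
    have "norm (fourier_transform \<mu> \<xi>) \<le> C * (1 + \<bar>\<xi>\<bar>) powr (- \<beta> / 2)" for \<xi>
      using C(2)[of "- \<xi>"] by (simp add: transform)
    then show ?thesis
      unfolding fourier_dim_def using \<mu> C(1) \<beta> by (intro SUP_upper) auto
  qed
  show "1 \<le> fourier_dim cantor_set"
  proof (rule ereal_le_epsilon2)
    fix e :: real assume e: "0 < e"
    define \<beta> where "\<beta> = max 0 (1 - e)"
    have "1 \<le> \<beta> + e" by (simp add: \<beta>_def)
    then have "1 \<le> ereal \<beta> + ereal e" by (simp add: one_ereal_def)
    also have "\<dots> \<le> fourier_dim cantor_set + ereal e"
      using dim[of \<beta>] e by (intro add_right_mono) (auto simp: \<beta>_def)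
    finally show "1 \<le> fourier_dim cantor_set + ereal e" .
  qed
qed

end

subsection \<open>Digits on a paraboloid\<close>

text \<open>Uniqueness of expansions with signed digits: \<open>W\<close> divides the lowest digit,
  which is smaller than \<open>W\<close> in absolute value and so vanishes; then divide by
  \<open>W\<close>. The top coefficient \<open>y\<close> may be arbitrarily large.\<close>

lemma small_digits_eq_0:
  fixes W y :: int and c :: "nat \<Rightarrow> int"
  assumes "\<And>j. j < n \<Longrightarrow> \<bar>c j\<bar> < W" "(\<Sum>j<n. c j * W ^ j) + y * W ^ n = 0"
  shows "(\<forall>j<n. c j = 0) \<and> y = 0"
  using assms
proof (induction n arbitrary: c)
  case (Suc n)
  have W: "W > 0" using Suc.prems(1)[of 0] by simp
  have eq: "c 0 + W * ((\<Sum>j<n. c (Suc j) * W ^ j) + y * W ^ n) = 0"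
    using Suc.prems(2) by (simp add: sum.lessThan_Suc_shift sum_distrib_left algebra_simps del: sum.lessThan_Suc)
  then have "W dvd c 0" by (metis add.commute add_eq_0_iff dvd_minus_iff dvd_triv_left)
  then have c0: "c 0 = 0" using Suc.prems(1)[of 0] zdvd_not_zless[of "\<bar>c 0\<bar>" W] by auto
  then have "(\<Sum>j<n. c (Suc j) * W ^ j) + y * W ^ n = 0" using eq W by simp
  then have "(\<forall>j<n. c (Suc j) = 0) \<and> y = 0"
    using Suc.prems(1) by (intro Suc.IH) auto
  then show ?case using c0 by (auto simp: less_Suc_eq_0_disj)
qed simp

text \<open>
  The points \<open>(x, |x|\<^sup>2)\<close> of a paraboloid, written in base \<open>W\<close>. The lowest digit is left empty
  to absorb carries.
\<close>

definition encode :: "nat \<Rightarrow> int \<Rightarrow> (nat \<Rightarrow> int) \<Rightarrow> int" where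
  "encode n W x = (\<Sum>j<n. x j * W ^ Suc j) + (\<Sum>j<n. (x j)\<^sup>2) * W ^ Suc n"

definition paraboloid :: "nat \<Rightarrow> int \<Rightarrow> int \<Rightarrow> int set" where
  "paraboloid n s W = encode n W ` ({..<n} \<rightarrow>\<^sub>E {0..<s})"

lemma weighted_difference_bound:
  fixes m :: "nat \<Rightarrow> nat" and f :: "nat \<Rightarrow> int"
  assumes "m 0 = (\<Sum>i=1..v. m i)" "m 0 \<le> M" "\<And>i. i \<le> v \<Longrightarrow> 0 \<le> f i \<and> f i \<le> K"
  shows "\<bar>int (m 0) * f 0 - (\<Sum>i=1..v. int (m i) * f i)\<bar> \<le> int M * K"
proof -
  have K: "K \<ge> 0" using assms(3)[of 0] by simp
  have "int (m 0) * f 0 \<le> int (m 0) * K" "0 \<le> int (m 0) * f 0"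
    using assms(3)[of 0] by (auto intro: mult_left_mono)
  moreover have "(\<Sum>i=1..v. int (m i) * f i) \<le> (\<Sum>i=1..v. int (m i) * K)"
    using assms(3) by (intro sum_mono mult_left_mono) auto
  moreover have "(\<Sum>i=1..v. int (m i) * K) = int (m 0) * K"
    by (simp add: assms(1) sum_distrib_right)
  moreover have "0 \<le> (\<Sum>i=1..v. int (m i) * f i)"
    using assms(3) by (intro sum_nonneg) auto
  moreover have "int (m 0) * K \<le> int M * K" using assms(2) K by (intro mult_right_mono) auto
  ultimately show ?thesis by linarith
qed

text \<open>Variance identity: the weighted sum of squared distances to the mean is the weighted sum
  of squares minus \<open>m 0\<close> times the square of the mean. It vanishes here, hence so does
  every term.\<close>

lemma paraboloid_strictly_convex:
  fixes m :: "nat \<Rightarrow> nat" and x :: "nat \<Rightarrow> nat \<Rightarrow> int"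
  assumes m: "\<And>i. i \<le> v \<Longrightarrow> 1 \<le> m i" "m 0 = (\<Sum>i=1..v. m i)"
    and lin: "\<And>j. j < n \<Longrightarrow> int (m 0) * x 0 j = (\<Sum>i=1..v. int (m i) * x i j)"
    and quad: "int (m 0) * (\<Sum>j<n. (x 0 j)\<^sup>2) = (\<Sum>i=1..v. int (m i) * (\<Sum>j<n. (x i j)\<^sup>2))"
    and i: "i \<le> v" "j < n"
  shows "x i j = x 0 j"
proof -
  have "(\<Sum>i=1..v. int (m i) * (\<Sum>j<n. (x i j - x 0 j)\<^sup>2)) =
      (\<Sum>i=1..v. int (m i) * (\<Sum>j<n. (x i j)\<^sup>2)) - 2 * (\<Sum>i=1..v. int (m i) * (\<Sum>j<n. x i j * x 0 j))
      + (\<Sum>i=1..v. int (m i) * (\<Sum>j<n. (x 0 j)\<^sup>2))"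
    by (simp add: power2_diff sum_subtractf sum.distrib sum_distrib_left algebra_simps)
  also have "(\<Sum>i=1..v. int (m i) * (\<Sum>j<n. (x 0 j)\<^sup>2)) = int (m 0) * (\<Sum>j<n. (x 0 j)\<^sup>2)"
    by (simp add: m(2) sum_distrib_right)
  also have "(\<Sum>i=1..v. int (m i) * (\<Sum>j<n. x i j * x 0 j)) = (\<Sum>j<n. (\<Sum>i=1..v. int (m i) * x i j) * x 0 j)"
    unfolding sum_distrib_left sum_distrib_right by (subst sum.swap) (simp add: mult_ac)
  also have "\<dots> = (\<Sum>j<n. int (m 0) * x 0 j * x 0 j)" by (intro sum.cong) (simp_all add: lin)
  also have "\<dots> = int (m 0) * (\<Sum>j<n. (x 0 j)\<^sup>2)"
    by (simp add: sum_distrib_left power2_eq_square mult_ac)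
  finally have 0: "(\<Sum>i=1..v. int (m i) * (\<Sum>j<n. (x i j - x 0 j)\<^sup>2)) = 0" using quad by simp
  show ?thesis
  proof (cases "i = 0")
    case False
    have "int (m i) * (\<Sum>j<n. (x i j - x 0 j)\<^sup>2) = 0"
      using 0 False i by (subst (asm) sum_nonneg_eq_0_iff) (auto intro!: mult_nonneg_nonneg sum_nonneg)
    then have "(\<Sum>j<n. (x i j - x 0 j)\<^sup>2) = 0" using m(1)[OF i(1)] by simp
    then have "(x i j - x 0 j)\<^sup>2 = 0" using i(2) by (subst (asm) sum_nonneg_eq_0_iff) auto
    then show ?thesis by simp
  qed simp
qed

text \<open>The equation is read off in base \<open>W\<close>: lowest digit \<open>- c\<close>, then
  one digit for each linear coordinate, then the quadratic defect. The size bounds exclude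
  interaction between positions, so the points satisfy the equation exactly and convexity
  applies.\<close>

lemma encode_rigid:
  fixes m :: "nat \<Rightarrow> nat" and x :: "nat \<Rightarrow> nat \<Rightarrow> int" and s W c :: int
  assumes W: "W = int M * s" and s: "s \<ge> 2" and n: "int n \<le> W"
    and m: "\<And>i. i \<le> v \<Longrightarrow> 1 \<le> m i" "m 0 = (\<Sum>i=1..v. m i)" "m 0 \<le> M"
    and x: "\<And>i j. i \<le> v \<Longrightarrow> j < n \<Longrightarrow> 0 \<le> x i j \<and> x i j < s"
    and c: "\<bar>c\<bar> \<le> int M"
    and dvd: "W ^ (n + 4) dvd int (m 0) * encode n W (x 0) - (\<Sum>i=1..v. int (m i) * encode n W (x i)) - c"
    and i: "i \<le> v" "j < n"
  shows "x i j = x 0 j"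
proof -
  have M: "M \<ge> 1" using m(1)[of 0] m(3) by linarith
  have W_gt: "W > int M"
  proof -
    have "int M * 1 < int M * s" using M s by (intro mult_strict_left_mono) auto
    then show ?thesis by (simp add: W)
  qed
  define C where "C j = int (m 0) * x 0 j - (\<Sum>i=1..v. int (m i) * x i j)" for j
  define D where "D = int (m 0) * (\<Sum>j<n. (x 0 j)\<^sup>2) - (\<Sum>i=1..v. int (m i) * (\<Sum>j<n. (x i j)\<^sup>2))"
  have C: "\<bar>C j\<bar> < W" if "j < n" for j
  proof -
    have "\<bar>C j\<bar> \<le> int M * (s - 1)"
      unfolding C_def using weighted_difference_bound[OF m(2,3), of "\<lambda>i. x i j" "s - 1"] x that by auto
    also have "\<dots> < W" using M by (simp add: W algebra_simps)
    finally show ?thesis .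
  qed
  \<comment> \<open>A sum of \<open>n\<close> squares is at most \<open>n * (s - 1) ^ 2\<close>.
    With \<open>n\<close> at most \<open>W\<close> and \<open>W = M * s\<close>, three powers of
    \<open>W\<close> suffice.\<close>
  have D: "\<bar>D\<bar> < W ^ 3"
  proof -
    have sq: "0 \<le> (\<Sum>j<n. (x i j)\<^sup>2) \<and> (\<Sum>j<n. (x i j)\<^sup>2) \<le> int n * (s - 1)\<^sup>2" if "i \<le> v" for i
    proof
      have "(x i j)\<^sup>2 \<le> (s - 1)\<^sup>2" if "j < n" for j
        using x[OF \<open>i \<le> v\<close> that] by (intro power_mono) auto
      then have "(\<Sum>j<n. (x i j)\<^sup>2) \<le> (\<Sum>j<n. (s - 1)\<^sup>2)" by (intro sum_mono) auto
      then show "(\<Sum>j<n. (x i j)\<^sup>2) \<le> int n * (s - 1)\<^sup>2" by simp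
    qed (simp add: sum_nonneg)
    have "\<bar>D\<bar> \<le> int M * (int n * (s - 1)\<^sup>2)"
      unfolding D_def using weighted_difference_bound[OF m(2,3), of "\<lambda>i. \<Sum>j<n. (x i j)\<^sup>2"] sq by blast
    also have "\<dots> \<le> int M * (W * (s - 1)\<^sup>2)" using n by (intro mult_left_mono mult_right_mono) auto
    also have "\<dots> < int M * (W * s\<^sup>2)"
      using M W_gt s by (intro mult_strict_left_mono power_strict_mono) auto
    also have "\<dots> \<le> int M * (int M * (W * s\<^sup>2))"
      using M W_gt mult_right_mono[of 1 "int M" "int M * (W * s\<^sup>2)"] by simp
    also have "\<dots> = W ^ 3" by (simp add: W power2_eq_square power3_eq_cube)
    finally show ?thesis .
  qed
  have split: "int (m 0) * encode n W (x 0) - (\<Sum>i=1..v. int (m i) * encode n W (x i))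
      = (\<Sum>j<n. C j * W ^ Suc j) + D * W ^ Suc n"
  proof -
    have "(\<Sum>i=1..v. int (m i) * encode n W (x i)) =
        (\<Sum>j<n. \<Sum>i=1..v. int (m i) * x i j * W ^ Suc j) + (\<Sum>i=1..v. int (m i) * (\<Sum>j<n. (x i j)\<^sup>2)) * W ^ Suc n"
      unfolding encode_def
      by (subst sum.swap) (simp only: distrib_left sum.distrib sum_distrib_left sum_distrib_right mult.assoc)
    moreover have "(\<Sum>j<n. C j * W ^ Suc j) =
        (\<Sum>j<n. int (m 0) * x 0 j * W ^ Suc j) - (\<Sum>j<n. \<Sum>i=1..v. int (m i) * x i j * W ^ Suc j)"
      by (simp only: C_def left_diff_distrib sum_subtractf sum_distrib_right)
    moreover have "int (m 0) * encode n W (x 0) =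
        (\<Sum>j<n. int (m 0) * x 0 j * W ^ Suc j) + int (m 0) * (\<Sum>j<n. (x 0 j)\<^sup>2) * W ^ Suc n"
      by (simp only: encode_def distrib_left sum_distrib_left sum_distrib_right mult.assoc)
    ultimately show ?thesis unfolding D_def by (simp only: left_diff_distrib)
  qed
  obtain q where q: "(\<Sum>j<n. C j * W ^ Suc j) + D * W ^ Suc n - c = W ^ (n + 4) * q"
    using dvd unfolding split by (elim dvdE)
  \<comment> \<open>The empty position 0 receives the carry. The modulus exceeds
    \<open>W ^ Suc n\<close> by the factor \<open>W ^ 3\<close>, so it affects only the top
    coefficient, and by a multiple of \<open>W ^ 3\<close>.\<close>
  define d where "d j = (case j of 0 \<Rightarrow> - c | Suc j \<Rightarrow> C j)" for j
  have "(\<Sum>j<Suc n. d j * W ^ j) + (D - W ^ 3 * q) * W ^ Suc n = 0"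
  proof -
    have "(\<Sum>j<Suc n. d j * W ^ j) = (\<Sum>j<n. C j * W ^ Suc j) - c"
      by (simp add: sum.lessThan_Suc_shift d_def del: sum.lessThan_Suc)
    moreover have "W ^ (n + 4) * q = W ^ 3 * q * W ^ Suc n"
      by (simp add: power_add numeral_eq_Suc)
    ultimately show ?thesis using q unfolding left_diff_distrib by linarith
  qed
  moreover have "\<bar>d j\<bar> < W" if "j < Suc n" for j
    using C c W_gt that by (cases j) (auto simp: d_def)
  ultimately have "(\<forall>j<Suc n. d j = 0) \<and> D - W ^ 3 * q = 0"
    by (intro small_digits_eq_0)
  then have dz: "\<And>j. j < Suc n \<Longrightarrow> d j = 0" and Dq: "D = W ^ 3 * q" by simp_all
  have Cz: "C j = 0" if "j < n" for j
    using dz[of "Suc j"] that by (simp add: d_def)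
  have "W ^ 3 dvd D" using Dq by simp
  then have "D = 0" using D zdvd_not_zless[of "\<bar>D\<bar>" "W ^ 3"] by auto
  show ?thesis
  proof (rule paraboloid_strictly_convex[OF m(1,2), where x = x and n = n])
    show "int (m 0) * x 0 j = (\<Sum>i=1..v. int (m i) * x i j)" if "j < n" for j
      using Cz[OF that] unfolding C_def by simp
    show "int (m 0) * (\<Sum>j<n. (x 0 j)\<^sup>2) = (\<Sum>i=1..v. int (m i) * (\<Sum>j<n. (x i j)\<^sup>2))"
      using \<open>D = 0\<close> unfolding D_def by simp
  qed (use i in auto)
qed

lemma rigid_paraboloid:
  assumes "W = int M * s" "s \<ge> 2" "int n \<le> W"
  shows "rigid M (W ^ (n + 4)) (paraboloid n s W)"
  unfolding rigid_def
proof (intro allI impI)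
  fix v i c and m :: "nat \<Rightarrow> nat" and b :: "nat \<Rightarrow> int"
  assume m: "\<forall>i\<le>v. 1 \<le> m i" "m 0 = (\<Sum>i=1..v. m i)" "m 0 \<le> M"
    and b: "\<forall>i\<le>v. b i \<in> paraboloid n s W" and c: "\<bar>c\<bar> \<le> int M"
    and dvd: "W ^ (n + 4) dvd int (m 0) * b 0 - (\<Sum>i=1..v. int (m i) * b i) - c" and i: "i \<le> v"
  obtain x where x: "\<And>i. i \<le> v \<Longrightarrow> x i \<in> {..<n} \<rightarrow>\<^sub>E {0..<s}" "\<And>i. i \<le> v \<Longrightarrow> b i = encode n W (x i)"
    using b unfolding paraboloid_def image_iff by metis
  have "(\<Sum>i=1..v. int (m i) * b i) = (\<Sum>i=1..v. int (m i) * encode n W (x i))"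
    using x(2) by (intro sum.cong) auto
  then have dvd': "W ^ (n + 4) dvd int (m 0) * encode n W (x 0) - (\<Sum>i=1..v. int (m i) * encode n W (x i)) - c"
    using dvd x(2)[of 0] by simp
  have "x i j = x 0 j" if "j < n" for j
    by (rule encode_rigid[OF assms, where x = x and m = m and v = v and c = c])
      (use m x(1) c i that dvd' in \<open>auto simp: PiE_iff\<close>)
  then show "b i = b 0" using x(2)[OF i] x(2)[of 0] by (simp add: encode_def)
qed

text \<open>Injectivity of the encoding is \<open>encode_rigid\<close> for the two-term equation
  with unit coefficients and no carry.\<close>

lemma card_paraboloid:
  assumes "W = int M * s" "s \<ge> 2" "int n \<le> W" "M \<ge> 1"
  shows "card (paraboloid n s W) = nat s ^ n"
proof -
  have "inj_on (encode n W) ({..<n} \<rightarrow>\<^sub>E {0..<s})"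
  proof (rule inj_onI)
    fix x y assume xy: "x \<in> {..<n} \<rightarrow>\<^sub>E {0..<s}" "y \<in> {..<n} \<rightarrow>\<^sub>E {0..<s}" "encode n W x = encode n W y"
    define z where "z = (\<lambda>i::nat. if i = 0 then x else y)"
    have "z 1 j = z 0 j" if "j < n" for j
    proof (rule encode_rigid[OF assms(1-3), where m = "\<lambda>_. 1" and v = 1 and c = 0 and x = z])
      show "0 \<le> z i j \<and> z i j < s" if "j < n" for i j
        using PiE_mem[OF xy(1), of j] PiE_mem[OF xy(2), of j] that by (simp add: z_def)
    qed (use assms(4) xy(3) that in \<open>simp_all add: z_def\<close>)
    then show "x = y"
      using xy(1,2) by (intro PiE_ext[of _ "{..<n}" "\<lambda>_. {0..<s}"]) (auto simp: z_def)
  qed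
  then show ?thesis by (simp add: paraboloid_def card_image card_PiE)
qed

subsection \<open>Parameters growing with the level\<close>

text \<open>The summands here and in \<open>sum_levels\<close> are the base \<open>M\<close>
  logarithms of the number of digits and of the modulus at level \<open>j\<close>.\<close>

lemma sum_squares_Suc: "(\<Sum>j<k. real ((j + 1) * (j + 1))) = k * (k + 1) * (2 * k + 1) / 6"
  by (induction k) (auto simp: field_simps)

lemma sum_levels: "(\<Sum>j<k. real ((j + 2) * (j + 5))) = k * (k + 1) * (2 * k + 1) / 6 + 5 * k * (k + 1) / 2 + 4 * k"
  by (induction k) (auto simp: field_simps)

text \<open>Both \<open>q\<close> and \<open>p\<close> grow like \<open>k ^ 3 / 3\<close>, and
  passing from \<open>k\<close> to \<open>Suc k\<close> in \<open>q\<close> changes only lower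
  orders. For \<open>a < 1 / 2\<close> the exponent thus has a negative cubic leading term.\<close>

lemma summable_exp_neg_cubic:
  fixes a l :: real
  assumes "a < 1 / 2" "l > 0"
  defines "q \<equiv> (\<lambda>k. k * (k + 1) * (2 * k + 1) / 6 + 5 * k * (k + 1) / 2 + 4 * k)"
  defines "p \<equiv> (\<lambda>k. k * (k + 1) * (2 * k + 1) / 6)"
  shows "summable (\<lambda>k. exp (l * (a * q (real (Suc k)) - p (real k) / 2)) * (8 * (q (real (Suc k)) * l) + 32))"
proof (rule summable_comparison_test_bigo)
  define c where "c = l * (1 / 2 - a) / 3"
  have c: "c > 0" using assms by (simp add: c_def)
  have "l * (a * q (real (Suc k)) - p (real k) / 2) = - c * real k ^ 3 + l * (4 * a - 1 / 4) * real k ^ 2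
      + l * (41 / 3 * a - 1 / 12) * real k + 10 * l * a" for k
    by (simp add: q_def p_def c_def field_simps power2_eq_square power3_eq_cube)
  moreover have "8 * (q (real (Suc k)) * l) + 32 = 8 * l * (real k ^ 3 / 3 + 4 * real k ^ 2 + 41 / 3 * real k + 10) + 32" for k
    by (simp add: q_def field_simps power2_eq_square power3_eq_cube)
  moreover have "(\<lambda>k. exp (- c * real k ^ 3 + d * real k ^ 2 + e * real k + f) *
      (8 * l * (real k ^ 3 / 3 + 4 * real k ^ 2 + 41 / 3 * real k + 10) + 32)) \<in> O(\<lambda>k. 1 / real k ^ 2)" for d e f
    using c \<open>l > 0\<close> by real_asymp
  ultimately show "(\<lambda>k. exp (l * (a * q (real (Suc k)) - p (real k) / 2)) * (8 * (q (real (Suc k)) * l) + 32))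
    \<in> O(\<lambda>k. 1 / real k ^ 2)" by (simp only:)
  show "summable (\<lambda>k. norm (1 / real k ^ 2))"
    using inverse_power_summable[of 2, where 'a = real] by (simp add: inverse_eq_divide)
qed

lemma exists_rigid_set_of_full_fourier_dim:
  assumes M: "M \<ge> 2"
  shows "\<exists>E. closed E \<and> E \<subseteq> {0..1} \<and> fourier_dim E = 1 \<and>
    (\<forall>v (m :: nat \<Rightarrow> nat) x. (\<forall>i\<le>v. 1 \<le> m i) \<longrightarrow> m 0 = (\<Sum>i=1..v. m i) \<longrightarrow> m 0 \<le> M \<longrightarrow>
      (\<forall>i\<le>v. x i \<in> E) \<longrightarrow> real (m 0) * x 0 = (\<Sum>i=1..v. real (m i) * x i) \<longrightarrow> (\<forall>i\<le>v. x i = x 0))"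
proof -
  \<comment> \<open>Dimension and side length grow together: the digit set has
    \<open>M ^ ((k + 1) ^ 2)\<close> elements and the modulus is
    \<open>M ^ ((k + 2) * (k + 5))\<close>, so the ratio of the exponents tends to 1.\<close>
  define s W :: "nat \<Rightarrow> int" where "s k = int M ^ Suc k" and "W k = int M * s k" for k
  define N where "N k = W k ^ (Suc k + 4)" for k
  define B where "B k = paraboloid (Suc k) (s k) (W k)" for k
  have s: "s k \<ge> 2" for k
  proof -
    have "int M ^ 1 \<le> int M ^ Suc k" using M by (intro power_increasing) auto
    then show ?thesis using M unfolding s_def power_one_right by linarith
  qed
  have n: "int (Suc k) \<le> W k" for k
  proof -
    have "Suc k < 2 ^ Suc k" by (rule less_exp)
    also have "(2::nat) ^ Suc k \<le> M ^ Suc k" using M by (rule power_mono) simp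
    finally have "int (Suc k) \<le> int (M ^ Suc k)" by (simp only: of_nat_le_iff less_imp_le)
    also have "\<dots> \<le> W k" using M by (simp add: W_def s_def)
    finally show ?thesis .
  qed
  have rigid: "rigid M (N k) (B k)" for k
    unfolding N_def B_def using W_def s n by (rule rigid_paraboloid)
  have card_B: "card (B k) = M ^ (Suc k * Suc k)" for k
  proof -
    have "card (B k) = nat (s k) ^ Suc k"
      unfolding B_def using W_def s n by (rule card_paraboloid) (use M in simp)
    also have "nat (s k) = M ^ Suc k" unfolding s_def by (simp only: nat_power_eq of_nat_0_le_iff nat_int)
    finally show ?thesis by (simp only: power_mult)
  qed
  have N_eq: "N k = int M ^ ((k + 2) * (k + 5))" for k
  proof -
    have "W k = int M ^ (k + 2)" by (simp add: W_def s_def)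
    moreover have "Suc k + 4 = k + 5" by simp
    ultimately show ?thesis unfolding N_def by (simp only: power_mult)
  qed
  interpret digit_sets N B
  proof
    fix k
    have "int M ^ 1 \<le> N k" unfolding N_eq using M by (intro power_increasing) auto
    then show "2 \<le> N k" using M unfolding power_one_right by linarith
    have "card (B k) > 0" using M by (simp add: card_B)
    then show "finite (B k)" "B k \<noteq> {}" by (auto simp: card_gt_0_iff)
    show "inj_on (\<lambda>b. b mod N k) (B k)" using rigid_imp_inj_on_mod[OF rigid] M by simp
  qed
  have "\<exists>L \<tau>. cantor_tree N B L \<tau>"
  proof -
    obtain L where L: "L 0 = {0}" and "\<forall>k. L k \<subseteq> {0..<Q k} \<and> card (L k) = P k \<and>
      (\<exists>\<tau>. L (Suc k) = child k \<tau> ` (L k \<times> B k) \<and>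
        (\<forall>\<theta>. norm (level_error k (L k) \<tau> \<theta>) \<le> (8 * ln (Q (Suc k)) + 32) * sqrt (P k)))"
      using exists_tree by (elim exE conjE)
    then obtain \<tau> where "\<forall>k. L k \<subseteq> {0..<Q k} \<and> card (L k) = P k \<and>
      L (Suc k) = child k (\<tau> k) ` (L k \<times> B k) \<and>
      (\<forall>\<theta>. norm (level_error k (L k) (\<tau> k) \<theta>) \<le> (8 * ln (Q (Suc k)) + 32) * sqrt (P k))"
      by metis
    then have "cantor_tree N B L \<tau>" using L by unfold_locales simp_all
    then show ?thesis by blast
  qed
  then obtain L \<tau> where "cantor_tree N B L \<tau>" by blast
  then interpret cantor_tree N B L \<tau> .
  define l where "l = ln (real M)"
  define q where "q k = k * (k + 1) * (2 * k + 1) / 6 + 5 * k * (k + 1) / 2 + 4 * k" for k :: real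
  define p where "p k = k * (k + 1) * (2 * k + 1) / 6" for k :: real
  have l: "l > 0" using M by (simp add: l_def)
  have Q: "real_of_int (Q k) = exp (l * q (real k))" for k
  proof -
    have "Q k = int M ^ (\<Sum>j<k. (j + 2) * (j + 5))" unfolding Q_def N_eq by (simp add: power_sum)
    then have "real_of_int (Q k) = exp l ^ (\<Sum>j<k. (j + 2) * (j + 5))" using M by (simp add: l_def)
    also have "\<dots> = exp (real (\<Sum>j<k. (j + 2) * (j + 5)) * l)" by (simp only: exp_of_nat_mult)
    also have "real (\<Sum>j<k. (j + 2) * (j + 5)) = q (real k)"
      unfolding of_nat_sum sum_levels q_def by simp
    finally show ?thesis by (simp only: mult.commute)
  qed
  have P: "real (P k) = exp (l * p (real k))" for k
  proof -
    have "P k = M ^ (\<Sum>j<k. (j + 1) * (j + 1))" unfolding P_def card_B by (simp add: power_sum)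
    then have "real (P k) = exp l ^ (\<Sum>j<k. (j + 1) * (j + 1))" using M by (simp add: l_def)
    also have "\<dots> = exp (real (\<Sum>j<k. (j + 1) * (j + 1)) * l)" by (simp only: exp_of_nat_mult)
    also have "real (\<Sum>j<k. (j + 1) * (j + 1)) = p (real k)"
      unfolding of_nat_sum sum_squares_Suc p_def by simp
    finally show ?thesis by (simp only: mult.commute)
  qed
  have term_eq: "Q (Suc k) powr a * (8 * ln (Q (Suc k)) + 32) / sqrt (P k)
      = exp (l * (a * q (real (Suc k)) - p (real k) / 2)) * (8 * (q (real (Suc k)) * l) + 32)" for a k
  proof -
    have "sqrt (P k) = exp (l * p (real k) / 2)"
      unfolding P by (simp add: powr_def flip: powr_half_sqrt)
    moreover have "Q (Suc k) powr a = exp (l * (a * q (real (Suc k))))"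
      unfolding Q by (simp add: powr_def mult_ac)
    ultimately show ?thesis unfolding Q by (simp add: exp_diff right_diff_distrib mult_ac)
  qed
  have "fourier_dim cantor_set = 1"
  proof (rule fourier_dim_cantor_set)
    fix a :: real assume "a < 1 / 2"
    then show "summable (\<lambda>k. Q (Suc k) powr a * (8 * ln (Q (Suc k)) + 32) / sqrt (P k))"
      unfolding term_eq q_def p_def using l by (rule summable_exp_neg_cubic)
  qed
  moreover have "\<forall>v (m :: nat \<Rightarrow> nat) x. (\<forall>i\<le>v. 1 \<le> m i) \<longrightarrow> m 0 = (\<Sum>i=1..v. m i) \<longrightarrow> m 0 \<le> M \<longrightarrow>
      (\<forall>i\<le>v. x i \<in> cantor_set) \<longrightarrow> real (m 0) * x 0 = (\<Sum>i=1..v. real (m i) * x i) \<longrightarrow> (\<forall>i\<le>v. x i = x 0)"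
    using cantor_set_rigid[OF rigid] by blast
  ultimately show ?thesis using closed_cantor_set cantor_set_subset by blast
qed

section \<open>Passing from finitely many forms to a common coefficient bound\<close>

theorem theorem1p5:
  fixes G :: "((nat \<Rightarrow> real) \<Rightarrow> real) set"
  assumes "finite G" and "G \<subseteq> all_forms"
  shows "\<exists>E :: real set. E \<in> sets borel \<and> E \<subseteq> {0..1} \<and> fourier_dim E = 1 \<and>
    (\<forall>v\<ge>2. \<forall>f \<in> G \<inter> forms v. \<not> (\<exists>x. nontrivial_zero v f E x))"
proof -
  \<comment> \<open>Evaluation at the first unit vector recovers the coefficient \<open>m\<^sub>0\<close> from a form.\<close>
  define e :: "nat \<Rightarrow> real" where "e i = (if i = 0 then 1 else 0)" for i
  \<comment> \<open>The inserted 2 makes the maximum well defined for empty \<open>G\<close> and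
    provides the base \<open>M \<ge> 2\<close> of the construction.\<close>
  define M where "M = Max (insert 2 ((\<lambda>f. nat \<lceil>f e\<rceil>) ` G))"
  have "M \<ge> 2" unfolding M_def using assms(1) by (intro Max_ge) auto
  then obtain E where E: "closed E" "E \<subseteq> {0..1}" "fourier_dim E = 1"
    and rigid: "\<forall>v (m :: nat \<Rightarrow> nat) x. (\<forall>i\<le>v. 1 \<le> m i) \<longrightarrow> m 0 = (\<Sum>i=1..v. m i) \<longrightarrow> m 0 \<le> M \<longrightarrow>
      (\<forall>i\<le>v. x i \<in> E) \<longrightarrow> real (m 0) * x 0 = (\<Sum>i=1..v. real (m i) * x i) \<longrightarrow> (\<forall>i\<le>v. x i = x 0)"
    by (rule exE[OF exists_rigid_set_of_full_fourier_dim]) (elim conjE)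
  have "\<not> nontrivial_zero v f E x" if v: "v \<ge> 2" and f: "f \<in> G" "f \<in> forms v" for v f x
  proof
    assume zero: "nontrivial_zero v f E x"
    obtain m where m: "\<forall>i\<le>v. 1 \<le> m i" "m 0 = (\<Sum>i=1..v. m i)"
      and f_eq: "f = (\<lambda>x. real (m 0) * x 0 - (\<Sum>i=1..v. real (m i) * x i))"
      using f(2) unfolding forms_def by blast
    have "(\<Sum>i=1..v. real (m i) * e i) = 0" by (intro sum.neutral) (auto simp: e_def)
    then have "f e = real (m 0)" unfolding f_eq by (simp add: e_def)
    moreover have "nat \<lceil>f e\<rceil> \<le> M" unfolding M_def using assms(1) f(1) by (intro Max_ge) auto
    ultimately have "m 0 \<le> M" by simp
    moreover have "real (m 0) * x 0 = (\<Sum>i=1..v. real (m i) * x i)"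
      using zero unfolding nontrivial_zero_def f_eq by simp
    moreover have "\<forall>i\<le>v. x i \<in> E" and inj: "inj_on x {0..v}"
      using zero unfolding nontrivial_zero_def by blast+
    ultimately have *: "\<forall>i\<le>v. x i = x 0" using rigid m by blast
    have "x 1 = x 0" by (rule *[rule_format]) (use v in simp)
    then show False using inj_onD[OF inj, of 1 0] v by simp
  qed
  then show ?thesis using E by (intro exI[of _ E]) auto
qed

end
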